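(* Let $m\geq 1$ be an integer, let $L_+=|\nabla|-\frac{2m}{1+x^2}$ and $L_-=L_++R$, and let $\{\psi_k\}_{k=0}^{2m}$ be the functions $$\psi_k=\varphi_k\ \ (0\le k\le 2m-2),\qquad \psi_{2m-1}=\frac{\varphi_{2m-1}}{1+x^2},\qquad \psi_{2m}=\frac{\varphi}{1+x^2}.$$ Suppose that $f,g\in\dot H^{1/2}(\mathbb{R})$ satisfy $$\int_{\mathbb{R}}\psi_kf\,dx=\int_{\mathbb{R}}\psi_kg\,dx=0\quad\text{for }0\le k\le2m.$$ Then $$(f,L_+f)+(g,L_-g)\ \geq\ \frac1{m+1}\left(\|f\|_{\dot H^{1/2}}^2+\|g\|_{\dot H^{1/2}}^2\right).$$
   Context: $|\nabla|=\sqrt{-\Delta}$ on $\mathbb{R}$. $\dot H^{1/2}(\mathbb{R})$ is the space of real-valued $f\in L^1_{loc}(\mathbb{R})$ with $\int\frac{|f(x)|}{1+x^2}dx<\infty$ and $\|f\|^2_{\dot H^{1/2}}=\int f|\nabla|f\,dx=\frac1{2\pi}\iint\frac{|f(x)-f(y)|^2}{|x-y|^2}dx\,dy<\infty$. Let $f_m(x)=\mathrm{Re}\left(i\cdot\frac{x-i}{x+i}\right)^m$, $g_m(x)=\mathrm{Im}\left(i\cdot\frac{x-i}{x+i}\right)^m$, $\mathbf{Q}_m=(f_m,g_m,0):\mathbb{R}\to\mathbb{S}^2$, and $$(Rf)(x)=\frac1{2\pi}\int_{\mathbb{R}}\frac{|\mathbf{Q}_m(x)-\mathbf{Q}_m(y)|^2}{|x-y|^2}f(y)\,dy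 .$$ $(f,L_+f)$ and $(g,L_-g)$ denote the quadratic forms $$(f,L_+f)=\|f\|_{\dot H^{1/2}}^2-\int\frac{2m}{1+x^2}|f|^2dx,\qquad (g,L_-g)=(g,L_+g)+\int g\,Rg\,dx .$$ Acting on $L^2(\mathbb{R})$ with domain $H^1(\mathbb{R})$, the operator $L_+$ has exactly $2m$ eigenvalues $E_0<\dots<E_{2m-2}<E_{2m-1}=0$, all simple; $\varphi_k$ ($0\le k\le 2m-1$) denotes the (real-valued, $L^2$-normalized) eigenfunction for $E_k$. The function $\varphi\in\dot H^{1/2}(\mathbb{R})\setminus L^2(\mathbb{R})$ is the zero-energy resonance of $L_+$: $\varphi=g_m$ if $m$ is odd and $\varphi=f_m$ if $m$ is even. One has $|\psi_k(x)|\lesssim (1+x^2)^{-1}$, so the pairings are well defined. *)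

theory Defs
  imports "HOL-Analysis.Analysis"
begin

text \<open>
  Elements of \<open>L\<^sup>2\<close>, \<open>L\<^sup>1\<^sub>l\<^sub>o\<^sub>c\<close>, \<open>H\<^sup>1\<close> and \<open>H\<^sup>1\<^sup>/\<^sup>2\<close> are represented by Borel functions, that is, by Borel
  representatives of classes modulo equality almost everywhere. Operators defined on such classes
  are given by their graphs.
\<close>

definition L2_fun :: "(real \<Rightarrow> complex) \<Rightarrow> bool" where
  "L2_fun u \<longleftrightarrow> u \<in> borel_measurable borel \<and> integrable lborel (\<lambda>x. (norm (u x))\<^sup>2)"

text \<open>
  The Fourier transform on \<open>L\<^sup>2\<close>: \<open>U\<close> is the \<open>L\<^sup>2\<close> limit, as \<open>r\<close> tends to infinity, of the Fourier
  integrals of \<open>u\<close> truncated to \<open>[-r, r]\<close>.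
\<close>

definition L2_fourier :: "(real \<Rightarrow> complex) \<Rightarrow> (real \<Rightarrow> complex) \<Rightarrow> bool" where
  "L2_fourier u U \<longleftrightarrow> L2_fun u \<and> L2_fun U \<and>
     ((\<lambda>r::real. \<integral>\<^sup>+ \<xi>. ennreal ((norm (U \<xi> -
         (LINT x:{-r..r}|lborel. exp (- \<i> * of_real (\<xi> * x)) * u x)))\<^sup>2) \<partial>lborel)
       \<longlongrightarrow> 0) at_top"

definition H1 :: "(real \<Rightarrow> complex) \<Rightarrow> bool" where
  "H1 u \<longleftrightarrow> (\<exists>U. L2_fourier u U \<and> integrable lborel (\<lambda>\<xi>. (1 + \<xi>\<^sup>2) * (norm (U \<xi>))\<^sup>2))"

text \<open>\<open>|\<nabla>| u = h\<close>, where \<open>|\<nabla>| = \<surd>(-\<Delta>)\<close> is the Fourier multiplier with symbol \<open>|\<xi>|\<close>.\<close>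

definition abs_nabla :: "(real \<Rightarrow> complex) \<Rightarrow> (real \<Rightarrow> complex) \<Rightarrow> bool" where
  "abs_nabla u h \<longleftrightarrow> (\<exists>U. L2_fourier u U \<and> L2_fourier h (\<lambda>\<xi>. of_real \<bar>\<xi>\<bar> * U \<xi>))"

text \<open>\<open>L\<^sub>+ u = v\<close>, as an operator on \<open>L\<^sup>2\<close> with domain \<open>H\<^sup>1\<close>.\<close>

definition Lplus :: "nat \<Rightarrow> (real \<Rightarrow> complex) \<Rightarrow> (real \<Rightarrow> complex) \<Rightarrow> bool" where
  "Lplus m u v \<longleftrightarrow> H1 u \<and> L2_fun v \<and>
     (\<exists>h. abs_nabla u h \<and>
       (AE x in lborel. v x = h x - of_real (2 * real m / (1 + x\<^sup>2)) * u x))"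

definition Lplus_eigenfunction :: "nat \<Rightarrow> complex \<Rightarrow> (real \<Rightarrow> complex) \<Rightarrow> bool" where
  "Lplus_eigenfunction m z u \<longleftrightarrow>
     Lplus m u (\<lambda>x. z * u x) \<and> \<not> (AE x in lborel. u x = 0)"

definition Lplus_eigenvalues :: "nat \<Rightarrow> complex set" where
  "Lplus_eigenvalues m = {z. \<exists>u. Lplus_eigenfunction m z u}"

text \<open>
  On the diagonal, a Lebesgue null set, the difference quotients below have the value 0, since
  division by 0 yields 0.
\<close>

definition Hdot_half :: "(real \<Rightarrow> real) set" where
  "Hdot_half = {f. f \<in> borel_measurable borel \<and>
     (\<forall>K. compact K \<longrightarrow> set_integrable lborel K f) \<and>
     integrable lborel (\<lambda>x. \<bar>f x\<bar> / (1 + x\<^sup>2)) \<and>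
     integrable (lborel \<Otimes>\<^sub>M lborel) (\<lambda>(x, y). \<bar>f x - f y\<bar>\<^sup>2 / \<bar>x - y\<bar>\<^sup>2)}"

definition Hdot_half_norm_sq :: "(real \<Rightarrow> real) \<Rightarrow> real" where
  "Hdot_half_norm_sq f =
     1 / (2 * pi) * (LINT (x, y)|(lborel \<Otimes>\<^sub>M lborel). \<bar>f x - f y\<bar>\<^sup>2 / \<bar>x - y\<bar>\<^sup>2)"

definition f_fun :: "nat \<Rightarrow> real \<Rightarrow> real" where
  "f_fun m x = Re ((\<i> * ((of_real x - \<i>) / (of_real x + \<i>))) ^ m)"

definition g_fun :: "nat \<Rightarrow> real \<Rightarrow> real" where
  "g_fun m x = Im ((\<i> * ((of_real x - \<i>) / (of_real x + \<i>))) ^ m)"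

definition Q_map :: "nat \<Rightarrow> real \<Rightarrow> real ^ 3" where
  "Q_map m x = vector [f_fun m x, g_fun m x, 0]"

definition R_op :: "nat \<Rightarrow> (real \<Rightarrow> real) \<Rightarrow> real \<Rightarrow> real" where
  "R_op m f x =
     1 / (2 * pi) * (LINT y|lborel. (norm (Q_map m x - Q_map m y))\<^sup>2 / \<bar>x - y\<bar>\<^sup>2 * f y)"

definition Lplus_form :: "nat \<Rightarrow> (real \<Rightarrow> real) \<Rightarrow> real" where
  "Lplus_form m f =
     Hdot_half_norm_sq f - (LINT x|lborel. 2 * real m / (1 + x\<^sup>2) * \<bar>f x\<bar>\<^sup>2)"

definition Lminus_form :: "nat \<Rightarrow> (real \<Rightarrow> real) \<Rightarrow> real" where
  "Lminus_form m g = Lplus_form m g + (LINT x|lborel. g x * R_op m g x)"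

definition resonance :: "nat \<Rightarrow> real \<Rightarrow> real" where
  "resonance m = (if odd m then g_fun m else f_fun m)"

definition psi :: "nat \<Rightarrow> (nat \<Rightarrow> real \<Rightarrow> real) \<Rightarrow> nat \<Rightarrow> real \<Rightarrow> real" where
  "psi m \<phi> k x =
     (if k \<le> 2 * m - 2 then \<phi> k x
      else if k = 2 * m - 1 then \<phi> (2 * m - 1) x / (1 + x\<^sup>2)
      else resonance m x / (1 + x\<^sup>2))"

end

theory Submission imports Defs "HOL-Probability.Distributions" "Jordan_Normal_Form.Determinant"
begin

text \<open>
  Put \<open>\<zeta> = (1 + i x) / (1 - i x)\<close> (\<open>cay\<close>), a point of the unit circle, and \<open>rho = 2 / (1 + x\<^sup>2)\<close>, so that
  \<open>rho dx\<close> is arc length. Let \<open>c\<^sub>n\<close> be the integral of \<open>f rho \<zeta>\<^sup>n\<close> (\<open>circle_coeff\<close>). The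
  \<open>H\<^sup>1\<^sup>/\<^sup>2\<close> seminorm is conformally invariant and the potential \<open>2 m / (1 + x\<^sup>2)\<close> is \<open>m rho\<close>, so the quadratic
  form of \<open>L\<^sub>+\<close> is \<open>\<Sum> (|n| - m) |c\<^sub>n|\<^sup>2 / 2\<pi>\<close>. If \<open>c\<^sub>n = 0\<close> for all \<open>|n| \<le> m\<close>, then
  only modes with \<open>|n| \<ge> m + 1\<close> remain, for which \<open>|n| - m \<ge> |n| / (m + 1)\<close>: this is the asserted
  inequality for \<open>f\<close> (\<open>Hdot_half_norm_sq_ge\<close>, \<open>Lplus_form_ge\<close>). The same vanishing gives \<open>R g = 0\<close>,
  because the kernel of \<open>R\<close> contains only modes below \<open>m\<close> (\<open>R_op_eq_0\<close>). Everything thus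
  rests on the fact that orthogonality to all \<open>\<psi>\<^sub>k\<close> removes the modes \<open>|n| \<le> m\<close>
  (\<open>low_circle_coeff_zero\<close>).

  Let \<open>v\<close> be an eigenfunction of \<open>L\<^sub>+\<close> with eigenvalue \<open>E\<close>, let \<open>c\<^sub>n\<close> now be its coefficients, and let
  \<open>d\<^sub>n = (|n| - m) c\<^sub>n\<close>. On the circle the eigenvalue equation is the recurrence
  \<open>2 E c\<^sub>n = d\<^sub>n\<^sub>+\<^sub>1 + 2 d\<^sub>n + d\<^sub>n\<^sub>-\<^sub>1\<close> (\<open>eigen_recurrence\<close>). It is obtained by testing the equation with powers
  of \<open>1 / (1 + i x)\<close>, the Fourier transforms of \<open>\<xi>\<^sup>k e\<^sup>-\<^sup>\<xi>\<close> on a half-line, for which \<open>|\<nabla>|\<close>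
  is explicit. Since \<open>d\<^sub>n = 0\<close> at \<open>n = \<plusminus> m\<close>, the modes beyond \<open>m\<close> decouple, and for \<open>E \<le> 0\<close> the recurrence
  keeps them bounded away from 0 unless they all vanish (\<open>eigen_coeff_vanish\<close>). By completeness of the powers of \<open>\<zeta>\<close>,
  every eigenfunction with \<open>E \<le> 0\<close> is a trigonometric polynomial of degree at most \<open>m\<close>, and \<open>E v\<close>
  is \<open>rho\<close> times the one with coefficients \<open>d\<^sub>n\<close>, of degree below \<open>m\<close> (\<open>eigen_pairing\<close>).

  The \<open>2 m - 1\<close> eigenfunctions with \<open>E < 0\<close> are orthogonal, so orthogonality to all of
  them is a nonsingular linear system for the \<open>2 m - 1\<close> inner modes of \<open>f\<close>. For \<open>E = 0\<close> only the
  modes \<open>\<plusminus> m\<close> survive, and decay at infinity leaves the multiples of \<open>Im \<zeta>\<^sup>m\<close> (\<open>zero_mode\<close>). The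
  resonance is \<open>\<plusminus> Re \<zeta>\<^sup>m\<close>. Together these two remove the modes \<open>\<plusminus> m\<close> of \<open>f\<close>.
\<close>

section \<open>The Cayley transform\<close>

text \<open>
  The Cayley transform maps the line onto the unit circle minus \<open>- 1\<close>, which is the image of the
  point at infinity. With angle \<open>\<theta> = 2 arctan x\<close> it is \<open>e\<^sup>i\<^sup>\<theta>\<close>.
\<close>

definition cay :: "real \<Rightarrow> complex" where
  "cay x = (1 + \<i> * of_real x) / (1 - \<i> * of_real x)"

text \<open>
  The density of arc length in the coordinate \<open>x\<close>: \<open>d\<theta> = rho x dx\<close>.
\<close>

definition rho :: "real \<Rightarrow> real" where
  "rho x = 2 / (1 + x\<^sup>2)"

lemma one_plus_ii_ne [simp]: "1 + \<i> * of_real x \<noteq> 0" "1 - \<i> * of_real x \<noteq> 0"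
  by (auto simp: complex_eq_iff)

lemma rho_pos [simp]: "rho x > 0"
  unfolding rho_def by (intro divide_pos_pos) (auto simp: add_pos_nonneg)

lemma rho_nonneg [simp]: "rho x \<ge> 0"
  using rho_pos[of x] by linarith

lemma cay_eq_cis: "cay x = cis (2 * arctan x)"
proof -
  have "cay x * (1 - \<i> * of_real x) = 1 + \<i> * of_real x"
    by (simp add: cay_def)
  moreover have "cis (2 * arctan x) * (1 - \<i> * of_real x) = 1 + \<i> * of_real x"
  proof -
    have c: "cos (arctan x) \<noteq> 0" by (rule cos_arctan_not_zero)
    have x: "x = sin (arctan x) / cos (arctan x)" by (metis tan_arctan tan_def)
    have "1 + \<i> * of_real x = cis (arctan x) / of_real (cos (arctan x))"
      using c by (subst x) (simp add: complex_eq_iff)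
    moreover have "1 - \<i> * of_real x = cis (- arctan x) / of_real (cos (arctan x))"
      using c by (subst x) (simp add: complex_eq_iff)
    moreover have "cis (2 * arctan x) * cis (- arctan x) = cis (arctan x)"
      by (simp add: cis_mult)
    ultimately show ?thesis by simp
  qed
  ultimately show ?thesis by (metis mult_right_cancel one_plus_ii_ne(2))
qed

lemma norm_cay [simp]: "norm (cay x) = 1" by (simp add: cay_eq_cis)

lemma cay_ne_0 [simp]: "cay x \<noteq> 0" using norm_cay[of x] by force

lemma cay_powi: "cay x powi n = cis (of_int n * (2 * arctan x))"
  by (simp add: cay_eq_cis cis_power_int)

lemma norm_cay_powi [simp]: "norm (cay x powi n) = 1" by (simp add: norm_power_int)

lemma cnj_cay_powi: "cnj (cay x powi n) = cay x powi (- n)"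
  by (simp add: cay_powi cis_cnj)

lemma continuous_cay: "continuous_on A cay"
  unfolding cay_eq_cis[abs_def] by (intro continuous_intros)

lemma cay_measurable [measurable]: "cay \<in> borel_measurable borel"
  by (intro borel_measurable_continuous_onI continuous_cay)

lemma cay_powi_measurable [measurable]: "(\<lambda>x. cay x powi n) \<in> borel_measurable borel"
  unfolding cay_powi by (intro borel_measurable_continuous_onI continuous_intros)

lemma rho_measurable [measurable]: "rho \<in> borel_measurable borel"
  unfolding rho_def by measurable

lemma one_plus_cay: "1 + cay x = 2 / (1 - \<i> * of_real x)"
  unfolding cay_def by (simp add: field_simps)

lemma one_plus_cay_inverse: "1 + inverse (cay x) = 2 / (1 + \<i> * of_real x)"
  unfolding cay_def by (simp add: field_simps)

lemma rho_eq: "of_real (rho x) = 2 / ((1 + \<i> * of_real x) * (1 - \<i> * of_real x))"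
proof -
  have "(1 + \<i> * of_real x) * (1 - \<i> * of_real x) = of_real (1 + x\<^sup>2)"
    by (simp add: algebra_simps power2_eq_square)
  then show ?thesis unfolding rho_def by simp
qed

text \<open>
  The weight is \<open>1 + cos \<theta>\<close>. This is why multiplication by it couples only neighbouring
  Fourier coefficients.
\<close>

lemma rho_eq_cay: "of_real (rho x) = (2 + cay x + inverse (cay x)) / 2"
proof -
  have "(2 + cay x + inverse (cay x)) = (1 + cay x) * (1 + inverse (cay x))"
    by (simp add: algebra_simps)
  then show ?thesis unfolding one_plus_cay one_plus_cay_inverse rho_eq by (simp add: mult.commute)
qed

text \<open>
  This identity is the conformal invariance of the \<open>H\<^sup>1\<^sup>/\<^sup>2\<close> seminorm: the measure
  \<open>dx dy / (x - y)\<^sup>2\<close> is \<open>d\<theta> d\<theta>' / |e\<^sup>i\<^sup>\<theta> - e\<^sup>i\<^sup>\<theta>'|\<^sup>2\<close> on the circle.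
\<close>

lemma norm_cay_diff_sq: "(norm (cay x - cay y))\<^sup>2 = rho x * rho y * (x - y)\<^sup>2"
proof -
  have "cay x - cay y = 2 * \<i> * of_real (x - y) / ((1 - \<i> * of_real x) * (1 - \<i> * of_real y))"
    unfolding cay_def by (simp add: field_simps)
  then have "(norm (cay x - cay y))\<^sup>2
      = 4 * (x - y)\<^sup>2 / ((norm (1 - \<i> * of_real x))\<^sup>2 * (norm (1 - \<i> * of_real y))\<^sup>2)"
    by (simp add: norm_divide norm_mult power_divide power_mult_distrib
             del: of_real_diff)
  moreover have "(norm (1 - \<i> * of_real t))\<^sup>2 = 1 + t\<^sup>2" for t :: real
    by (simp add: cmod_power2)
  ultimately show ?thesis by (simp add: rho_def)
qed

lemma cay_inj: "cay x = cay y \<Longrightarrow> x = y"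
  using norm_cay_diff_sq[of x y] by (auto simp: less_imp_neq[OF rho_pos, symmetric])

lemma
  shows integrable_rho: "integrable lborel rho" and integral_rho: "(LINT x|lborel. rho x) = 2 * pi"
proof -
  let ?F = "\<lambda>x. 2 * arctan x"
  have 1: "DERIV ?F x :> rho x" for x
    unfolding rho_def by (auto intro!: derivative_eq_intros simp: field_simps)
  have 2: "isCont rho x" for x unfolding rho_def
    by (intro continuous_intros) (auto simp: add_nonneg_eq_0_iff)
  have A: "((?F \<circ> real_of_ereal) \<longlongrightarrow> - pi) (at_right (-\<infinity>))"
    using tendsto_mult[OF tendsto_const tendsto_arctan_at_bot, of 2]
    by (simp add: ereal_tendsto_simps)
  have B: "((?F \<circ> real_of_ereal) \<longlongrightarrow> pi) (at_left \<infinity>)"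
    using tendsto_mult[OF tendsto_const tendsto_arctan_at_top, of 2]
    by (simp add: ereal_tendsto_simps)
  note * = interval_integral_FTC_nonneg[of "-\<infinity>" \<infinity> ?F rho, OF _ 1 2 _ A B]
  show "integrable lborel rho"
    using *(1) by (simp add: set_integrable_def)
  show "(LINT x|lborel. rho x) = 2 * pi"
    using *(2) by (simp add: interval_integral_to_infinity_eq interval_lebesgue_integral_def set_lebesgue_integral_def)
qed

lemma integrable_rho_cay_powi: "integrable lborel (\<lambda>x. of_real (rho x) * cay x powi n)"
  by (rule Bochner_Integration.integrable_bound[OF integrable_rho])
     (auto simp: norm_mult)

text \<open>
  An antiderivative of \<open>rho \<zeta>\<^sup>n\<close>, where \<open>\<zeta> = cay x\<close>, is \<open>\<zeta>\<^sup>n / (i n)\<close>, and \<open>\<zeta>\<close> has the same limit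
  at both ends of the line.
\<close>

lemma integral_rho_cay_powi:
  "(LINT x|lborel. of_real (rho x) * cay x powi n) = (if n = 0 then of_real (2 * pi) else 0)"
proof (cases "n = 0")
  case True
  then show ?thesis using integral_rho by (simp add: integral_complex_of_real)
next
  case False
  let ?F = "\<lambda>x. cis (of_int n * (2 * arctan x)) / (\<i> * of_int n)"
  have 1: "(?F has_vector_derivative (of_real (rho x) * cay x powi n)) (at x)" for x
  proof -
    have "((\<lambda>x. cis (of_int n * (2 * arctan x))) has_vector_derivative
          (of_int n * rho x) *\<^sub>R (\<i> * cis (of_int n * (2 * arctan x)))) (at x)"
      unfolding rho_def
      by (auto intro!: derivative_eq_intros simp: has_vector_derivative_def field_simps)
    from has_vector_derivative_divide[OF this, of "\<i> * of_int n"] False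
    show ?thesis by (simp add: cay_powi scaleR_conv_of_real field_simps)
  qed
  have 2: "isCont (\<lambda>x. of_real (rho x) * cay x powi n) x" for x
  proof -
    have "continuous_on UNIV (\<lambda>x. of_real (rho x) * cay x powi n)"
      unfolding rho_def cay_powi
      by (intro continuous_intros) (auto simp: add_nonneg_eq_0_iff)
    then show ?thesis by (simp add: continuous_on_eq_continuous_at)
  qed
  have A: "((?F \<circ> real_of_ereal) \<longlongrightarrow> cis (of_int n * (2 * (-(pi/2)))) / (\<i> * of_int n)) (at_right (-\<infinity>))"
    unfolding ereal_tendsto_simps
    by (intro tendsto_intros tendsto_arctan_at_bot) (use False in auto)
  have B: "((?F \<circ> real_of_ereal) \<longlongrightarrow> cis (of_int n * (2 * (pi/2))) / (\<i> * of_int n)) (at_left \<infinity>)"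
    unfolding ereal_tendsto_simps
    by (intro tendsto_intros tendsto_arctan_at_top) (use False in auto)
  have "(LBINT x=-\<infinity>..\<infinity>. of_real (rho x) * cay x powi n) =
     cis (of_int n * (2 * (pi/2))) / (\<i> * of_int n) - cis (of_int n * (2 * (-(pi/2)))) / (\<i> * of_int n)"
    by (rule interval_integral_FTC_integrable[OF _ 1 2 _ A B])
       (use integrable_rho_cay_powi in \<open>auto simp: set_integrable_def\<close>)
  also have "\<dots> = 0"
    proof -
    have "cis (of_int n * (2 * (pi/2))) = cis (of_int n * (2 * (-(pi/2))))"
      using sin_npi_int[of n] by (simp add: complex_eq_iff mult.commute)
    then show ?thesis by simp
  qed
  finally show ?thesis using False
    by (simp add: interval_lebesgue_integral_def set_lebesgue_integral_def)
qed

section \<open>Fourier coefficients on the circle\<close>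

text \<open>
  Up to a factor \<open>2 \<pi>\<close> and the sign of the index, the Fourier coefficient of \<open>f\<close> regarded as a
  function on the circle.
\<close>

definition circle_coeff :: "(real \<Rightarrow> real) \<Rightarrow> int \<Rightarrow> complex" where
  "circle_coeff f n = (LINT x|lborel. of_real (f x * rho x) * cay x powi n)"

lemma integrable_weighted_cay_powi:
  assumes "integrable lborel (\<lambda>x. f x * rho x)"
  shows "integrable lborel (\<lambda>x. of_real (f x * rho x) * cay x powi n)"
proof (rule Bochner_Integration.integrable_bound[OF assms])
  have "(\<lambda>x. of_real (f x * rho x) :: complex) \<in> borel_measurable lborel"
    using borel_measurable_integrable[OF assms] by measurable
  then show "(\<lambda>x. of_real (f x * rho x) * cay x powi n) \<in> borel_measurable lborel"
    by measurable
qed (auto simp: norm_mult)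

lemma circle_coeff_uminus: "circle_coeff f (- n) = cnj (circle_coeff f n)"
proof -
  have "cnj (circle_coeff f n) = (LINT x|lborel. cnj (of_real (f x * rho x) * cay x powi n))"
    unfolding circle_coeff_def by (rule Bochner_Integration.integral_cnj[symmetric])
  then show ?thesis by (simp add: cnj_cay_powi circle_coeff_def del: complex_cnj_power_int)
qed

lemma integrable_weighted_of_square:
  assumes "f \<in> borel_measurable borel" "integrable lborel (\<lambda>x. (f x)\<^sup>2 * rho x)"
  shows "integrable lborel (\<lambda>x. f x * rho x)"
proof (rule Bochner_Integration.integrable_bound)
  show "integrable lborel (\<lambda>x. (f x)\<^sup>2 * rho x + rho x)"
    by (intro Bochner_Integration.integrable_add assms integrable_rho)
  show "(\<lambda>x. f x * rho x) \<in> borel_measurable lborel" using assms(1) by measurable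
  have "\<bar>t\<bar> \<le> t\<^sup>2 + 1" for t :: real
    using zero_le_power2[of "\<bar>t\<bar> - 1"] by (simp add: power2_diff)
  then have "\<bar>f x\<bar> * rho x \<le> ((f x)\<^sup>2 + 1) * rho x" for x by (intro mult_right_mono) auto
  then show "AE x in lborel. norm (f x * rho x) \<le> norm ((f x)\<^sup>2 * rho x + rho x)"
    by (auto simp: abs_mult algebra_simps)
qed

text \<open>
  Bessel's inequality, read off from the nonnegative weighted square distance between \<open>f\<close> and its
  partial Fourier sum.
\<close>

lemma bessel_circle_coeff:
  assumes f [measurable]: "f \<in> borel_measurable borel" and f2: "integrable lborel (\<lambda>x. (f x)\<^sup>2 * rho x)"
    and S: "finite S"
  shows "(\<Sum>n\<in>S. (norm (circle_coeff f n))\<^sup>2) \<le> 2 * pi * (LINT x|lborel. (f x)\<^sup>2 * rho x)"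
proof -
  define c where "c n = circle_coeff f n / (2 * pi)" for n
  define P where "P x = (\<Sum>n\<in>S. c n * cay x powi (- n))" for x
  note f1 = integrable_weighted_of_square[OF f f2]
  let ?B = "\<Sum>n\<in>S. (norm (circle_coeff f n))\<^sup>2"
  have cnjP: "cnj (P x) = (\<Sum>n\<in>S. cnj (c n) * cay x powi n)" for x
    unfolding P_def using cnj_cay_powi[of x "- n" for n] by (simp del: complex_cnj_power_int)
  have I1: "has_bochner_integral lborel (\<lambda>x. of_real (f x * rho x) * cnj (P x)) (of_real (?B / (2 * pi)))"
  proof -
    have "has_bochner_integral lborel (\<lambda>x. \<Sum>n\<in>S. cnj (c n) * (of_real (f x * rho x) * cay x powi n))
      (\<Sum>n\<in>S. cnj (c n) * circle_coeff f n)"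
      unfolding circle_coeff_def
      by (intro has_bochner_integral_sum has_bochner_integral_mult_right
          has_bochner_integral_integrable integrable_weighted_cay_powi f1)
    moreover have "(\<Sum>n\<in>S. cnj (c n) * circle_coeff f n) = of_real (?B / (2 * pi))"
      unfolding c_def of_real_divide of_real_sum sum_divide_distrib
      by (intro sum.cong) (auto simp: complex_norm_square mult.commute simp del: of_real_power)
    ultimately show ?thesis
      unfolding cnjP by (simp add: sum_distrib_left mult_ac)
  qed
  have I2: "has_bochner_integral lborel (\<lambda>x. of_real (rho x) * (P x * cnj (P x))) (of_real (?B / (2 * pi)))"
  proof -
    have "has_bochner_integral lborel
        (\<lambda>x. \<Sum>n\<in>S. \<Sum>l\<in>S. c n * cnj (c l) * (of_real (rho x) * cay x powi (l - n)))
        (\<Sum>n\<in>S. \<Sum>l\<in>S. c n * cnj (c l) * (if l - n = 0 then of_real (2 * pi) else 0))"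
      unfolding integral_rho_cay_powi[symmetric]
      by (intro has_bochner_integral_sum has_bochner_integral_mult_right
          has_bochner_integral_integrable integrable_rho_cay_powi)
    moreover have "(\<Sum>n\<in>S. \<Sum>l\<in>S. c n * cnj (c l) * (if l - n = 0 then of_real (2 * pi) else 0))
        = of_real (?B / (2 * pi))"
      unfolding of_real_divide of_real_sum sum_divide_distrib
      using S by (intro sum.cong)
        (auto simp: c_def if_distrib[of "(*) _"] sum.delta complex_norm_square simp del: of_real_power cong: if_cong)
    moreover have "of_real (rho x) * (P x * cnj (P x))
        = (\<Sum>n\<in>S. \<Sum>l\<in>S. c n * cnj (c l) * (of_real (rho x) * cay x powi (l - n)))" for x
      unfolding cnjP unfolding P_def sum_product
      by (simp add: sum_distrib_left power_int_diff power_int_minus divide_inverse mult_ac)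
    ultimately show ?thesis by simp
  qed
  have "has_bochner_integral lborel (\<lambda>x. (f x)\<^sup>2 * rho x) (LINT x|lborel. (f x)\<^sup>2 * rho x)"
    by (rule has_bochner_integral_integrable[OF f2])
  from has_bochner_integral_of_real[OF this, where 'a = complex]
  have I0: "has_bochner_integral lborel (\<lambda>x. complex_of_real ((f x)\<^sup>2 * rho x)) (of_real (LINT x|lborel. (f x)\<^sup>2 * rho x))" .
  have "has_bochner_integral lborel
      (\<lambda>x. complex_of_real ((f x)\<^sup>2 * rho x) - of_real (f x * rho x) * cnj (P x)
            - cnj (of_real (f x * rho x) * cnj (P x)) + of_real (rho x) * (P x * cnj (P x)))
      (of_real (LINT x|lborel. (f x)\<^sup>2 * rho x) - of_real (?B / (2 * pi)) - cnj (of_real (?B / (2 * pi)))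
         + of_real (?B / (2 * pi)))"
    by (intro has_bochner_integral_add has_bochner_integral_diff has_bochner_integral_cnj I0 I1 I2)
  moreover have "complex_of_real ((f x)\<^sup>2 * rho x) - of_real (f x * rho x) * cnj (P x)
            - cnj (of_real (f x * rho x) * cnj (P x)) + of_real (rho x) * (P x * cnj (P x))
         = of_real (rho x * (norm (of_real (f x) - P x))\<^sup>2)" for x
    unfolding of_real_mult complex_norm_square by (simp add: algebra_simps power2_eq_square)
  ultimately have "has_bochner_integral lborel (\<lambda>x. complex_of_real (rho x * (norm (of_real (f x) - P x))\<^sup>2))
     (of_real ((LINT x|lborel. (f x)\<^sup>2 * rho x) - ?B / (2 * pi)))"
    by simp
  then have "has_bochner_integral lborel (\<lambda>x. rho x * (norm (of_real (f x) - P x))\<^sup>2)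
     ((LINT x|lborel. (f x)\<^sup>2 * rho x) - ?B / (2 * pi))"
    by (metis (no_types, lifting) Re_complex_of_real has_bochner_integral_Re has_bochner_integral_cong)
  then have "(LINT x|lborel. rho x * (norm (of_real (f x) - P x))\<^sup>2)
     = (LINT x|lborel. (f x)\<^sup>2 * rho x) - ?B / (2 * pi)"
    by (rule has_bochner_integral_integral_eq)
  moreover have "0 \<le> (LINT x|lborel. rho x * (norm (of_real (f x) - P x))\<^sup>2)"
    by (rule Bochner_Integration.integral_nonneg) simp
  ultimately have "0 \<le> (LINT x|lborel. (f x)\<^sup>2 * rho x) - ?B / (2 * pi)"
    by simp
  then show ?thesis by (simp add: field_simps)
qed

section \<open>The spectral gap\<close>

text \<open>
  The unnormalised Fejer kernel in the angle difference. Times \<open>rho x rho y\<close> it is the kernel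
  \<open>|\<zeta>\<^sup>N - \<omega>\<^sup>N|\<^sup>2 / (x - y)\<^sup>2\<close> with \<open>\<zeta> = cay x\<close> and \<open>\<omega> = cay y\<close>: for \<open>N = m\<close> this is \<open>2 \<pi>\<close> times
  the kernel of \<open>R\<close>, and for large \<open>N\<close> it is a bounded substitute for the singular kernel of the
  \<open>H\<^sup>1\<^sup>/\<^sup>2\<close> seminorm.
\<close>

definition fejer :: "nat \<Rightarrow> real \<Rightarrow> real \<Rightarrow> real" where
  "fejer N x y = (norm (\<Sum>j<N. (cay x / cay y) ^ j))\<^sup>2"

lemma fejer_eq_sum:
  "of_real (fejer N x y) =
     (\<Sum>j<N. \<Sum>l<N. cay x powi (int j - int l) * cay y powi (- (int j - int l)))"
proof -
  let ?w = "cay x / cay y"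
  have w: "norm ?w = 1" by (simp add: norm_divide)
  then have "?w * cnj ?w = 1" by (metis complex_norm_square of_real_1 power_one)
  then have cnj_w: "cnj ?w = inverse ?w" by (metis inverse_unique)
  have w_term: "?w ^ j * cnj (?w ^ l) = cay x powi (int j - int l) * cay y powi (- (int j - int l))" for j l
  proof -
    have "?w ^ j * cnj (?w ^ l) = ?w ^ j / ?w ^ l"
      unfolding complex_cnj_power cnj_w by (metis divide_inverse power_inverse)
    also have "\<dots> = ?w powi (int j - int l)"
      by (simp add: power_int_diff)
    finally have "?w ^ j * cnj (?w ^ l) = ?w powi (int j - int l)" .
    then show ?thesis by (simp only: divide_inverse power_int_mult_distrib power_int_inverse power_int_minus)
  qed
  have "of_real (fejer N x y) = (\<Sum>j<N. \<Sum>l<N. ?w ^ j * cnj (?w ^ l))"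
    unfolding fejer_def complex_norm_square by (simp add: sum_product cnj_sum)
  then show ?thesis by (simp only: w_term)
qed

lemma norm_cay_power_diff_sq:
  "(norm (cay x ^ N - cay y ^ N))\<^sup>2 = rho x * rho y * (x - y)\<^sup>2 * fejer N x y"
proof -
  have "(cay x / cay y) ^ N - 1 = (cay x / cay y - 1) * (\<Sum>j<N. (cay x / cay y) ^ j)"
    by (rule power_diff_1_eq)
  moreover have "cay x ^ N - cay y ^ N = cay y ^ N * ((cay x / cay y) ^ N - 1)"
    by (simp add: algebra_simps power_divide)
  moreover have "norm (cay x / cay y - 1) = norm (cay x - cay y)"
  proof -
    have "cay x / cay y - 1 = (cay x - cay y) / cay y" by (simp add: field_simps)
    then show ?thesis by (simp add: norm_divide)
  qed
  ultimately have "norm (cay x ^ N - cay y ^ N) = norm (cay x - cay y) * norm (\<Sum>j<N. (cay x / cay y) ^ j)"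
    by (simp add: norm_mult norm_power)
  then show ?thesis by (simp add: power_mult_distrib norm_cay_diff_sq fejer_def)
qed

lemma has_bochner_integral_product:
  fixes a b :: "real \<Rightarrow> complex"
  assumes a: "integrable lborel a" and b: "integrable lborel b"
  shows "has_bochner_integral (lborel \<Otimes>\<^sub>M lborel) (\<lambda>(x, y). a x * b y)
     ((LINT x|lborel. a x) * (LINT y|lborel. b y))"
proof -
  have [measurable]: "a \<in> borel_measurable lborel" "b \<in> borel_measurable lborel"
    using a b by auto
  have "integrable (lborel \<Otimes>\<^sub>M lborel) (\<lambda>(x, y). a x * b y)"
  proof (rule lborel_pair.Fubini_integrable)
    show "(\<lambda>(x, y). a x * b y) \<in> borel_measurable (lborel \<Otimes>\<^sub>M lborel)" by measurable
    show "integrable lborel (\<lambda>x. LINT y|lborel. norm (case (x, y) of (x, y) \<Rightarrow> a x * b y))"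
      using a b by (simp add: norm_mult)
    show "AE x in lborel. integrable lborel (\<lambda>y. case (x, y) of (x, y) \<Rightarrow> a x * b y)"
      using b by simp
  qed
  moreover from lborel_pair.integral_fst'[OF this]
  have "(LINT z|(lborel \<Otimes>\<^sub>M lborel). (case z of (x, y) \<Rightarrow> a x * b y))
     = (LINT x|lborel. a x) * (LINT y|lborel. b y)"
    by simp
  ultimately show ?thesis by (simp add: has_bochner_integral_iff)
qed

text \<open>
  For a bounded kernel the square \<open>(f x - f y)\<^sup>2\<close> may be multiplied out. The two diagonal terms
  see only the zero mode of the kernel, which occurs \<open>N\<close> times, and the mixed term gives the
  coefficients of \<open>f\<close>.
\<close>

lemma has_bochner_integral_fejer_form:
  assumes f [measurable]: "f \<in> borel_measurable borel" and f2: "integrable lborel (\<lambda>x. (f x)\<^sup>2 * rho x)"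
  shows "has_bochner_integral (lborel \<Otimes>\<^sub>M lborel)
     (\<lambda>(x, y). (f x - f y)\<^sup>2 * (rho x * rho y * fejer N x y))
     (4 * pi * real N * (LINT x|lborel. (f x)\<^sup>2 * rho x)
       - 2 * (\<Sum>j<N. \<Sum>l<N. (norm (circle_coeff f (int j - int l)))\<^sup>2))"
proof -
  note f1 = integrable_weighted_of_square[OF f f2]
  define A where "A p = (LINT x|lborel. of_real ((f x)\<^sup>2 * rho x) * cay x powi p)" for p
  define r where "r p = (LINT x|lborel. of_real (rho x) * cay x powi p)" for p
  define c where "c = circle_coeff f"
  \<comment> \<open>The contribution of one mode of the kernel, multiplied out into products of one-variable functions.\<close>
  let ?F = "\<lambda>p x y. of_real ((f x)\<^sup>2 * rho x) * cay x powi p * (of_real (rho y) * cay y powi (- p))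
      - 2 * (of_real (f x * rho x) * cay x powi p * (of_real (f y * rho y) * cay y powi (- p)))
      + of_real (rho x) * cay x powi p * (of_real ((f y)\<^sup>2 * rho y) * cay y powi (- p))"
  have I: "has_bochner_integral (lborel \<Otimes>\<^sub>M lborel) (\<lambda>(x, y). ?F p x y)
      (A p * r (- p) - 2 * (c p * c (- p)) + r p * A (- p))" for p
    unfolding A_def r_def c_def circle_coeff_def case_prod_unfold
    using integrable_weighted_cay_powi[OF f1] integrable_weighted_cay_powi[OF f2] integrable_rho_cay_powi
    by (intro has_bochner_integral_add has_bochner_integral_diff has_bochner_integral_mult_right
        has_bochner_integral_product[unfolded case_prod_unfold])
  have "has_bochner_integral (lborel \<Otimes>\<^sub>M lborel)
     (\<lambda>z. \<Sum>j<N. \<Sum>l<N. (case z of (x, y) \<Rightarrow> ?F (int j - int l) x y))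
     (\<Sum>j<N. \<Sum>l<N. A (int j - int l) * r (- (int j - int l))
        - 2 * (c (int j - int l) * c (- (int j - int l))) + r (int j - int l) * A (- (int j - int l)))"
    by (intro has_bochner_integral_sum I)
  also have "(\<lambda>z. \<Sum>j<N. \<Sum>l<N. (case z of (x, y) \<Rightarrow> ?F (int j - int l) x y))
      = (\<lambda>z. of_real (case z of (x, y) \<Rightarrow> (f x - f y)\<^sup>2 * (rho x * rho y * fejer N x y)))"
  proof
    fix z :: "real \<times> real"
    obtain x y where z: "z = (x, y)" by (cases z)
    have "?F p x y = of_real ((f x - f y)\<^sup>2 * (rho x * rho y)) * (cay x powi p * cay y powi (- p))" for p
      by (simp add: power2_eq_square algebra_simps)
    then show "(\<Sum>j<N. \<Sum>l<N. (case z of (x, y) \<Rightarrow> ?F (int j - int l) x y))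
      = of_real (case z of (x, y) \<Rightarrow> (f x - f y)\<^sup>2 * (rho x * rho y * fejer N x y))"
      unfolding z prod.case of_real_mult[of _ "rho x * rho y * fejer N x y"]
        of_real_mult[of _ "fejer N x y"] fejer_eq_sum
      by (simp only: sum_distrib_left[symmetric] of_real_mult mult.assoc)
  qed
  also have "(\<Sum>j<N. \<Sum>l<N. A (int j - int l) * r (- (int j - int l))
        - 2 * (c (int j - int l) * c (- (int j - int l))) + r (int j - int l) * A (- (int j - int l)))
    = of_real (4 * pi * real N * (LINT x|lborel. (f x)\<^sup>2 * rho x)
       - 2 * (\<Sum>j<N. \<Sum>l<N. (norm (circle_coeff f (int j - int l)))\<^sup>2))"
  proof -
    have A0: "A 0 = of_real (LINT x|lborel. (f x)\<^sup>2 * rho x)"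
      unfolding A_def by (simp del: of_real_mult of_real_power)
    have cc: "c p * c (- p) = of_real ((norm (circle_coeff f p))\<^sup>2)" for p
      unfolding c_def circle_coeff_uminus complex_norm_square ..
    have "A p * r (- p) - 2 * (c p * c (- p)) + r p * A (- p)
       = (if p = 0 then of_real (4 * pi * (LINT x|lborel. (f x)\<^sup>2 * rho x)) else 0)
          - 2 * of_real ((norm (circle_coeff f p))\<^sup>2)" for p
      unfolding cc by (simp add: r_def integral_rho_cay_powi A0)
    then show ?thesis
      by (simp only: sum_subtractf)
         (simp add: sum_distrib_left sum.delta' cong: if_cong)
  qed
  finally have "has_bochner_integral (lborel \<Otimes>\<^sub>M lborel)
     (\<lambda>z. complex_of_real (case z of (x, y) \<Rightarrow> (f x - f y)\<^sup>2 * (rho x * rho y * fejer N x y)))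
     (of_real (4 * pi * real N * (LINT x|lborel. (f x)\<^sup>2 * rho x)
       - 2 * (\<Sum>j<N. \<Sum>l<N. (norm (circle_coeff f (int j - int l)))\<^sup>2)))" .
  from has_bochner_integral_Re[OF this] show ?thesis by simp
qed

text \<open>
  A difference \<open>p\<close> with \<open>|p| > m\<close> occurs at most \<open>N - m - 1\<close> times among the pairs of numbers
  below \<open>N\<close>.
\<close>

lemma sum_diff_square_le:
  fixes a :: "int \<Rightarrow> real"
  assumes nn: "\<And>p. a p \<ge> 0" and z: "\<And>p. \<bar>p\<bar> \<le> int m \<Longrightarrow> a p = 0"
    and B: "\<And>S. finite S \<Longrightarrow> sum a S \<le> B" and N: "m < N"
  shows "(\<Sum>j<N. \<Sum>l<N. a (int j - int l)) \<le> real (N - m - 1) * B"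
proof -
  let ?I = "{..<N} \<times> {..<N}"
  let ?d = "\<lambda>(j, l). int j - int l"
  have "(\<Sum>j<N. \<Sum>l<N. a (int j - int l)) = (\<Sum>z\<in>?I. a (?d z))"
    by (simp add: sum.cartesian_product case_prod_unfold)
  also have "\<dots> = (\<Sum>p\<in>?d ` ?I. \<Sum>z\<in>{z \<in> ?I. ?d z = p}. a (?d z))"
    by (rule sum.image_gen) auto
  also have "\<dots> = (\<Sum>p\<in>?d ` ?I. real (card {z \<in> ?I. ?d z = p}) * a p)"
    by (intro sum.cong) auto
  also have "\<dots> \<le> (\<Sum>p\<in>?d ` ?I. real (N - m - 1) * a p)"
  proof (intro sum_mono)
    fix p
    show "real (card {z \<in> ?I. ?d z = p}) * a p \<le> real (N - m - 1) * a p"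
    proof (cases "\<bar>p\<bar> \<le> int m")
      case False
      have "card {z \<in> ?I. ?d z = p} \<le> card {..<N - m - 1}"
      proof (cases "p > 0")
        case True
        with False show ?thesis
          by (intro card_inj_on_le[where f = snd]) (auto simp: inj_on_def)
      next
        case p: False
        with False show ?thesis
          by (intro card_inj_on_le[where f = fst]) (auto simp: inj_on_def)
      qed
      then show ?thesis using nn by (intro mult_right_mono) auto
    qed (simp add: z)
  qed
  also have "\<dots> \<le> real (N - m - 1) * B"
    unfolding sum_distrib_left[symmetric] by (intro mult_left_mono B) auto
  finally show ?thesis .
qed

text \<open>
  The geometric sums stay bounded.
\<close>

lemma average_unit_powers_tendsto_0:
  fixes w :: complex
  assumes "norm w = 1" "w \<noteq> 1"
  shows "(\<lambda>M. (\<Sum>N<M. w ^ (N + k)) / of_nat M) \<longlonglongrightarrow> 0"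
proof (rule Lim_null_comparison)
  show "eventually (\<lambda>M. norm ((\<Sum>N<M. w ^ (N + k)) / of_nat M) \<le> 2 / norm (w - 1) * (1 / real M)) sequentially"
  proof (intro always_eventually allI)
    fix M
    have "(\<Sum>N<M. w ^ (N + k)) = w ^ k * ((w ^ M - 1) / (w - 1))"
      using geometric_sum[OF assms(2), of M] by (simp add: power_add sum_distrib_right[symmetric] mult.commute)
    moreover have "norm (w ^ M - 1) \<le> 2"
      using norm_triangle_ineq4[of "w ^ M" 1] assms(1) by (simp add: norm_power)
    ultimately have "norm (\<Sum>N<M. w ^ (N + k)) \<le> 2 / norm (w - 1)"
      using assms by (simp add: norm_mult norm_divide norm_power divide_right_mono)
    then show "norm ((\<Sum>N<M. w ^ (N + k)) / of_nat M) \<le> 2 / norm (w - 1) * (1 / real M)"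
      by (cases "M = 0") (simp_all add: norm_divide field_simps)
  qed
  show "(\<lambda>M. 2 / norm (w - 1) * (1 / real M)) \<longlonglongrightarrow> 0"
    by (intro tendsto_mult_right_zero lim_1_over_n)
qed

text \<open>
  The spectral gap: on the circle \<open>|\<nabla>|\<close> acts on \<open>\<zeta>\<^sup>n\<close> as \<open>|n|\<close>, so functions without the modes
  \<open>|n| \<le> m\<close> have energy at least \<open>m + 1\<close>. Multiplying the integrand of the
  seminorm by \<open>|w\<^sup>N - 1|\<^sup>2\<close>, with \<open>w = cay x / cay y\<close>, gives the form with the Fejer kernel. For \<open>N > m\<close> that form is at least \<open>4 \<pi> (m + 1)\<close> times the weighted square
  integral, by Bessel's inequality and the count of differences. The average of \<open>|w\<^sup>N - 1|\<^sup>2\<close>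
  over \<open>N\<close> tends to 2 off the diagonal, and dominated convergence concludes.
\<close>

theorem Hdot_half_norm_sq_ge:
  assumes f: "f \<in> Hdot_half" and f2: "integrable lborel (\<lambda>x. (f x)\<^sup>2 * rho x)"
    and low: "\<And>n. \<bar>n\<bar> \<le> int m \<Longrightarrow> circle_coeff f n = 0"
  shows "(real m + 1) * (LINT x|lborel. (f x)\<^sup>2 * rho x) \<le> Hdot_half_norm_sq f"
proof -
  have fm [measurable]: "f \<in> borel_measurable borel" using f by (simp add: Hdot_half_def)
  let ?L = "lborel \<Otimes>\<^sub>M lborel :: (real \<times> real) measure"
  let ?I = "LINT x|lborel. (f x)\<^sup>2 * rho x"
  define G where "G = (\<lambda>(x, y). \<bar>f x - f y\<bar>\<^sup>2 / \<bar>x - y\<bar>\<^sup>2)"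
  have G: "integrable ?L G" using f unfolding Hdot_half_def G_def by simp
  have G0: "G z \<ge> 0" for z by (auto simp: G_def split: prod.split)
  define w where "w = (\<lambda>(x, y). cay x / cay y)"
  have w: "norm (w z) = 1" for z by (auto simp: w_def norm_divide split: prod.split)
  have [measurable]: "w \<in> borel_measurable ?L" unfolding w_def by measurable
  have [measurable]: "G \<in> borel_measurable ?L" using G by auto
  define D where "D N z = (norm (w z ^ N - 1))\<^sup>2" for N z
  have D: "has_bochner_integral ?L (\<lambda>z. G z * D N z) (4 * pi * real N * ?I
       - 2 * (\<Sum>j<N. \<Sum>l<N. (norm (circle_coeff f (int j - int l)))\<^sup>2))" for N
  proof -
    \<comment> \<open>On the diagonal both sides are 0.\<close>
    have "(\<lambda>z. G z * D N z) = (\<lambda>(x, y). (f x - f y)\<^sup>2 * (rho x * rho y * fejer N x y))"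
    proof (intro ext, clarify)
      fix x y
      have "w (x, y) ^ N - 1 = (cay x ^ N - cay y ^ N) / cay y ^ N"
        by (simp add: w_def field_simps)
      then have "D N (x, y) = (norm (cay x ^ N - cay y ^ N))\<^sup>2"
        by (simp add: D_def norm_divide norm_power)
      then have "D N (x, y) = rho x * rho y * (x - y)\<^sup>2 * fejer N x y"
        by (simp add: norm_cay_power_diff_sq)
      then show "G (x, y) * D N (x, y) = (f x - f y)\<^sup>2 * (rho x * rho y * fejer N x y)"
        by (cases "x = y") (auto simp: G_def)
    qed
    then show ?thesis using has_bochner_integral_fejer_form[OF fm f2] by simp
  qed
  have lower: "4 * pi * (real m + 1) * ?I \<le> (LINT z|?L. G z * D (N + (m + 1)) z)" for N
  proof -
    have "(\<Sum>j<N + (m + 1). \<Sum>l<N + (m + 1). (norm (circle_coeff f (int j - int l)))\<^sup>2)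
       \<le> real (N + (m + 1) - m - 1) * (2 * pi * ?I)"
      by (rule sum_diff_square_le) (use low bessel_circle_coeff[OF fm f2] in auto)
    then show ?thesis
      unfolding has_bochner_integral_integral_eq[OF D] by (simp add: algebra_simps)
  qed
  \<comment> \<open>The averages start at \<open>m + 1\<close>, where the lower bound becomes valid.\<close>
  define S where "S M z = (\<Sum>N<M. D (N + (m + 1)) z) / real M" for M z
  have D_eq: "D N z = 2 - 2 * Re (w z ^ N)" for N z
  proof -
    have "(norm (w z ^ N - 1))\<^sup>2 = (norm (w z ^ N))\<^sup>2 + 1 - 2 * Re (w z ^ N)"
      unfolding cmod_power2 by (simp add: power2_eq_square algebra_simps)
    then show ?thesis by (simp add: D_def norm_power w)
  qed
  have lim: "(\<lambda>M. LINT z|?L. G z * S M z) \<longlonglongrightarrow> (LINT z|?L. G z * 2)"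
  proof (rule integral_dominated_convergence[where w = "\<lambda>z. G z * 4"])
    show "(\<lambda>z. G z * 2) \<in> borel_measurable ?L" by measurable
    show "(\<lambda>z. G z * S M z) \<in> borel_measurable ?L" for M unfolding S_def D_def by measurable
    show "integrable ?L (\<lambda>z. G z * 4)" using G by simp
    show "AE z in ?L. norm (G z * S M z) \<le> G z * 4" for M
    proof (intro AE_I2)
      fix z
      have b: "\<bar>D N z\<bar> \<le> 4" for N
        using abs_Re_le_cmod[of "w z ^ N"] by (simp add: D_eq norm_power w abs_le_iff)
      have "\<bar>\<Sum>N<M. D (N + (m + 1)) z\<bar> \<le> (\<Sum>N<M. 4)"
        by (rule order_trans[OF sum_abs]) (intro sum_mono b)
      then have "\<bar>S M z\<bar> \<le> 4" unfolding S_def by (cases "M = 0") (auto simp: field_simps)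
      then show "norm (G z * S M z) \<le> G z * 4"
        using G0[of z] by (simp add: abs_mult mult_left_mono)
    qed
    show "AE z in ?L. (\<lambda>M. G z * S M z) \<longlonglongrightarrow> G z * 2"
    proof (intro AE_I2)
      fix z :: "real \<times> real"
      obtain x y where z: "z = (x, y)" by (cases z)
      show "(\<lambda>M. G z * S M z) \<longlonglongrightarrow> G z * 2"
      proof (cases "w z = 1")
        case True
        then have "x = y" using cay_inj[of x y] by (simp add: w_def z)
        then show ?thesis by (simp add: G_def z)
      next
        case False
        have "(\<lambda>M. 2 - 2 * Re ((\<Sum>N<M. w z ^ (N + (m + 1))) / of_nat M)) \<longlonglongrightarrow> 2 - 2 * Re 0"
          by (intro tendsto_intros average_unit_powers_tendsto_0 w False)
        moreover have "eventually (\<lambda>M. 2 - 2 * Re ((\<Sum>N<M. w z ^ (N + (m + 1))) / of_nat M) = S M z) sequentially"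
          using eventually_gt_at_top[of "0::nat"]
        proof eventually_elim
          case (elim M)
          have "S M z = (2 * real M - 2 * (\<Sum>N<M. Re (w z ^ (N + (m + 1))))) / real M"
            unfolding S_def D_eq by (simp add: sum_subtractf sum_distrib_left)
          moreover have "Re (u / of_nat M) = Re u / real M" for u
            by simp
          ultimately show ?case using elim by (simp add: diff_divide_distrib)
        qed
        ultimately have "(\<lambda>M. S M z) \<longlonglongrightarrow> 2" by (simp add: Lim_transform_eventually)
        then show ?thesis by (rule tendsto_mult_left)
      qed
    qed
  qed
  have "eventually (\<lambda>M. 4 * pi * (real m + 1) * ?I \<le> (LINT z|?L. G z * S M z)) sequentially"
    using eventually_gt_at_top[of "0::nat"]
  proof eventually_elim
    case (elim M)
    have "(LINT z|?L. G z * S M z) = (\<Sum>N<M. LINT z|?L. G z * D (N + (m + 1)) z) / real M"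
      unfolding S_def using has_bochner_integral_integrable[OF integrable.intros[OF D]]
      by (simp add: sum_distrib_left integrable.intros[OF D])
    moreover have "real M * (4 * pi * (real m + 1) * ?I) \<le> (\<Sum>N<M. LINT z|?L. G z * D (N + (m + 1)) z)"
      using sum_mono[of "{..<M}", OF lower] by simp
    ultimately show ?case using elim
      by (simp only: pos_le_divide_eq of_nat_0_less_iff mult.commute[of _ "real M"])
  qed
  from tendsto_lowerbound[OF lim this]
  have "4 * pi * (real m + 1) * ?I \<le> 2 * (LINT z|?L. G z)" by simp
  then show ?thesis unfolding Hdot_half_norm_sq_def G_def by (simp add: field_simps)
qed

section \<open>Test functions for the Fourier multiplier\<close>

lemma integrable_L2_mult:
  fixes a b :: "real \<Rightarrow> complex"
  assumes a: "L2_fun a" and b: "L2_fun b"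
  shows "integrable lborel (\<lambda>x. a x * b x)"
proof (rule Bochner_Integration.integrable_bound)
  show "integrable lborel (\<lambda>x. (norm (a x))\<^sup>2 + (norm (b x))\<^sup>2)"
    using a b by (auto simp: L2_fun_def)
  show "(\<lambda>x. a x * b x) \<in> borel_measurable lborel" using a b by (auto simp: L2_fun_def)
  have "s * t \<le> s\<^sup>2 + t\<^sup>2" for s t :: real
    using sum_squares_bound[of s t] zero_le_power2[of s] zero_le_power2[of t] by linarith
  then show "AE x in lborel. norm (a x * b x) \<le> norm ((norm (a x))\<^sup>2 + (norm (b x))\<^sup>2)"
    by (simp add: norm_mult)
qed

text \<open>
  The multiplication formula for the Fourier transform. For the truncated integrals it is Fubini's
  theorem. The truncated transforms converge in \<open>L\<^sup>2\<close>, and the Cauchy-Schwarz inequality passes to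
  the limit.
\<close>

lemma L2_fourier_pairing:
  assumes uU: "L2_fourier u U" and w1: "integrable lborel w" and w2: "L2_fun w"
    and W: "\<And>x. W x = (LINT \<xi>|lborel. exp (- \<i> * of_real (\<xi> * x)) * w \<xi>)" and W2: "L2_fun W"
  shows "(LINT \<xi>|lborel. U \<xi> * w \<xi>) = (LINT x|lborel. u x * W x)"
proof -
  have u: "L2_fun u" and U: "L2_fun U" using uU by (auto simp: L2_fourier_def)
  have [measurable]: "u \<in> borel_measurable borel" "U \<in> borel_measurable borel"
    "w \<in> borel_measurable borel" "W \<in> borel_measurable borel"
    using u U w2 W2 by (auto simp: L2_fun_def)
  define v where "v r x = indicat_real {-r..r} x *\<^sub>R u x" for r x
  have [measurable]: "v r \<in> borel_measurable borel" for r unfolding v_def[abs_def] by measurable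
  have v: "integrable lborel (v r)" for r
  proof (rule Bochner_Integration.integrable_bound)
    show "integrable lborel (\<lambda>x. (norm (u x))\<^sup>2 + indicat_real {-r..r} x)"
      by (intro Bochner_Integration.integrable_add)
         (use u in \<open>auto simp: L2_fun_def emeasure_lborel_Icc_eq\<close>)
    have "t \<le> t\<^sup>2 + 1" for t :: real
      using sum_squares_bound[of t 1] zero_le_power2[of t] unfolding mult_1_right power_one by linarith
    then show "AE x in lborel. norm (v r x) \<le> norm ((norm (u x))\<^sup>2 + indicat_real {-r..r} x)"
      unfolding v_def by (auto simp: indicator_def)
  qed measurable
  define F where "F r \<xi> = (LINT x|lborel. exp (- \<i> * of_real (\<xi> * x)) * v r x)" for r \<xi>
  have F_set: "(LINT x:{-r..r}|lborel. exp (- \<i> * of_real (\<xi> * x)) * u x) = F r \<xi>" for r \<xi>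
    unfolding F_def v_def set_lebesgue_integral_def by simp
  have e1: "norm (exp (- \<i> * of_real (\<xi> * x))) = 1" for \<xi> x :: real by (simp add: norm_exp)
  have [measurable]: "F r \<in> borel_measurable borel" for r
    unfolding F_def by (rule lborel.borel_measurable_lebesgue_integral) measurable
  have Fb: "norm (F r \<xi>) \<le> (LINT x|lborel. norm (v r x))" for r \<xi>
    unfolding F_def
    by (rule order_trans[OF integral_norm_bound]) (simp add: norm_mult e1)
  have Fw: "integrable lborel (\<lambda>\<xi>. F r \<xi> * w \<xi>)" for r
  proof (rule Bochner_Integration.integrable_bound)
    show "integrable lborel (\<lambda>\<xi>. (LINT x|lborel. norm (v r x)) * norm (w \<xi>))"
      using w1 by simp
    show "AE x in lborel. norm (F r x * w x) \<le> norm ((LBINT x. cmod (v r x)) * cmod (w x))"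
      using Fb by (auto simp: norm_mult intro!: mult_right_mono order_trans[OF _ abs_ge_self])
  qed simp
  have fub: "(LINT \<xi>|lborel. F r \<xi> * w \<xi>) = (LINT x|lborel. v r x * W x)" for r
  proof -
    have i: "integrable (lborel \<Otimes>\<^sub>M lborel) (\<lambda>(\<xi>, x). exp (- \<i> * of_real (\<xi> * x)) * v r x * w \<xi>)"
    proof (rule lborel_pair.Fubini_integrable)
      show "(\<lambda>(\<xi>, x). exp (- \<i> * of_real (\<xi> * x)) * v r x * w \<xi>) \<in> borel_measurable (lborel \<Otimes>\<^sub>M lborel)"
        by measurable
      show "integrable lborel (\<lambda>\<xi>. LINT x|lborel. norm (case (\<xi>, x) of (\<xi>, x) \<Rightarrow> exp (- \<i> * of_real (\<xi> * x)) * v r x * w \<xi>))"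
        using w1 by (simp add: norm_mult)
      have "integrable lborel (\<lambda>x. exp (- \<i> * of_real (\<xi> * x)) * v r x)" for \<xi>
        by (rule Bochner_Integration.integrable_bound[OF v[of r]]) (auto simp: norm_mult)
      then show "AE \<xi> in lborel. integrable lborel (\<lambda>x. case (\<xi>, x) of (\<xi>, x) \<Rightarrow> exp (- \<i> * of_real (\<xi> * x)) * v r x * w \<xi>)"
        by simp
    qed
    have "(LINT \<xi>|lborel. F r \<xi> * w \<xi>) = (LINT \<xi>|lborel. LINT x|lborel. exp (- \<i> * of_real (\<xi> * x)) * v r x * w \<xi>)"
      unfolding F_def by simp
    also have "\<dots> = (LINT x|lborel. LINT \<xi>|lborel. exp (- \<i> * of_real (\<xi> * x)) * v r x * w \<xi>)"
      using lborel_pair.Fubini_integral[OF i] by simp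
    also have "\<dots> = (LINT x|lborel. v r x * W x)"
    proof (rule Bochner_Integration.integral_cong)
      fix x
      have "(LINT \<xi>|lborel. exp (- \<i> * of_real (\<xi> * x)) * v r x * w \<xi>)
         = (LINT \<xi>|lborel. v r x * (exp (- \<i> * of_real (\<xi> * x)) * w \<xi>))"
        by (simp add: mult_ac)
      then show "(LINT \<xi>|lborel. exp (- \<i> * of_real (\<xi> * x)) * v r x * w \<xi>) = v r x * W x"
        by (simp add: W)
    qed simp
    finally show ?thesis .
  qed
  have lim1: "(\<lambda>n. LINT x|lborel. v (real n) x * W x) \<longlonglongrightarrow> (LINT x|lborel. u x * W x)"
  proof (rule integral_dominated_convergence[where w = "\<lambda>x. norm (u x * W x)"])
    show "integrable lborel (\<lambda>x. norm (u x * W x))" using integrable_L2_mult[OF u W2] by simp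
    show "AE x in lborel. (\<lambda>n. v (real n) x * W x) \<longlonglongrightarrow> u x * W x"
    proof (intro AE_I2 tendsto_eventually)
      fix x :: real
      have "eventually (\<lambda>n. \<bar>x\<bar> \<le> real n) sequentially"
        using filterlim_real_sequentially unfolding filterlim_at_top by blast
      then show "eventually (\<lambda>n. v (real n) x * W x = u x * W x) sequentially"
        by eventually_elim (auto simp: v_def indicator_def)
    qed
    show "AE x in lborel. norm (v (real n) x * W x) \<le> norm (u x * W x)" for n
      by (auto simp: v_def indicator_def)
  qed measurable
  have lim2: "(\<lambda>n. LINT \<xi>|lborel. F (real n) \<xi> * w \<xi>) \<longlonglongrightarrow> (LINT \<xi>|lborel. U \<xi> * w \<xi>)"
  proof -
    let ?D = "\<lambda>n. (LINT \<xi>|lborel. F (real n) \<xi> * w \<xi>) - (LINT \<xi>|lborel. U \<xi> * w \<xi>)"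
    let ?d = "\<lambda>n. \<integral>\<^sup>+ \<xi>. ennreal ((norm (U \<xi> - F (real n) \<xi>))\<^sup>2) \<partial>lborel"
    let ?c = "\<integral>\<^sup>+ \<xi>. ennreal ((norm (w \<xi>))\<^sup>2) \<partial>lborel"
    have "((\<lambda>r. \<integral>\<^sup>+ \<xi>. ennreal ((norm (U \<xi> - F r \<xi>))\<^sup>2) \<partial>lborel) \<longlongrightarrow> 0) at_top"
      using uU unfolding L2_fourier_def F_set by simp
    then have d: "?d \<longlonglongrightarrow> 0"
      by (rule filterlim_compose[OF _ filterlim_real_sequentially])
    have c: "?c < \<infinity>"
      using w2 by (auto simp: L2_fun_def integrable_iff_bounded)
    then have "(\<lambda>n. ?c * ?d n) \<longlonglongrightarrow> ?c * 0"
      by (intro ennreal_tendsto_cmult d) auto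
    then have "(\<lambda>n. ?d n * ?c) \<longlonglongrightarrow> 0" by (simp add: mult.commute)
    moreover have "ennreal ((norm (?D n))\<^sup>2) \<le> ?d n * ?c" for n
    proof -
      have i: "integrable lborel (\<lambda>\<xi>. (F (real n) \<xi> - U \<xi>) * w \<xi>)"
        using Fw[of "real n"] integrable_L2_mult[OF U w2] by (simp add: algebra_simps)
      have "?D n = (LINT \<xi>|lborel. (F (real n) \<xi> - U \<xi>) * w \<xi>)"
        using Fw[of "real n"] integrable_L2_mult[OF U w2] by (simp add: algebra_simps)
      then have "ennreal (norm (?D n)) \<le> (\<integral>\<^sup>+ \<xi>. ennreal (norm (U \<xi> - F (real n) \<xi>)) * ennreal (norm (w \<xi>)) \<partial>lborel)"
        using integral_norm_bound_ennreal[OF i]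
        by (simp add: norm_mult ennreal_mult' norm_minus_commute)
      then have "(ennreal (norm (?D n)))\<^sup>2 \<le> (\<integral>\<^sup>+ \<xi>. ennreal (norm (U \<xi> - F (real n) \<xi>)) * ennreal (norm (w \<xi>)) \<partial>lborel)\<^sup>2"
        by (intro power_mono) auto
      also have "\<dots> \<le> (\<integral>\<^sup>+ \<xi>. (ennreal (norm (U \<xi> - F (real n) \<xi>)))\<^sup>2 \<partial>lborel) * (\<integral>\<^sup>+ \<xi>. (ennreal (norm (w \<xi>)))\<^sup>2 \<partial>lborel)"
        by (rule Cauchy_Schwarz_nn_integral) measurable
      finally show ?thesis by (simp add: ennreal_power)
    qed
    ultimately have "(\<lambda>n. ennreal ((norm (?D n))\<^sup>2)) \<longlonglongrightarrow> 0"
      using tendsto_sandwich[of "\<lambda>_. 0" "\<lambda>n. ennreal ((norm (?D n))\<^sup>2)" sequentially "\<lambda>n. ?d n * ?c" 0]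
      by (simp add: always_eventually)
    then have "(\<lambda>n. ennreal ((norm (?D n))\<^sup>2)) \<longlonglongrightarrow> ennreal 0" by simp
    then have "(\<lambda>n. (norm (?D n))\<^sup>2) \<longlonglongrightarrow> 0"
      by (subst (asm) tendsto_ennreal_iff) auto
    from tendsto_real_sqrt[OF this] have "(\<lambda>n. norm (?D n)) \<longlonglongrightarrow> 0" by simp
    then show ?thesis by (rule LIM_zero_cancel[OF tendsto_norm_zero_cancel])
  qed
  show ?thesis using LIMSEQ_unique[OF lim2] lim1 fub by simp
qed

text \<open>
  Powers of this function are the test functions in the eigenvalue equation. Their Fourier
  transforms live on a half-line, where \<open>|\<nabla>|\<close> is \<open>i d/dx\<close> up to sign, and on the circle they
  are polynomials in \<open>1/\<zeta>\<close>.
\<close>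

definition pole :: "real \<Rightarrow> complex" where "pole x = 1 / (1 + \<i> * of_real x)"

definition laguerre_weight :: "nat \<Rightarrow> real \<Rightarrow> real" where
  "laguerre_weight k \<xi> = indicat_real {0..} \<xi> * (\<xi> ^ k * exp (- \<xi>))"

lemma laguerre_weight_measurable [measurable]: "laguerre_weight k \<in> borel_measurable borel"
  unfolding laguerre_weight_def by measurable

lemma laguerre_weight_nonneg: "laguerre_weight k \<xi> \<ge> 0"
  by (auto simp: laguerre_weight_def indicator_def)

lemma integrable_laguerre_weight: "integrable lborel (laguerre_weight k)"
proof (rule integrableI_nonneg)
  have "ennreal (laguerre_weight k \<xi>) = ennreal (\<xi> ^ k * exp (- \<xi>)) * indicator {0..} \<xi>" for \<xi>
    by (auto simp: laguerre_weight_def indicator_def)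
  then show "(\<integral>\<^sup>+ \<xi>. ennreal (laguerre_weight k \<xi>) \<partial>lborel) < \<infinity>"
    by (simp add: nn_intergal_power_times_exp_Ici)
qed (auto simp: laguerre_weight_nonneg)

lemma L2_laguerre_weight: "L2_fun (\<lambda>\<xi>. of_real (laguerre_weight k \<xi>))"
  unfolding L2_fun_def
proof
  show "integrable lborel (\<lambda>\<xi>. (norm (complex_of_real (laguerre_weight k \<xi>)))\<^sup>2)"
  proof (rule Bochner_Integration.integrable_bound[OF integrable_laguerre_weight[of "2 * k"]])
    have "(laguerre_weight k \<xi>)\<^sup>2 \<le> laguerre_weight (2 * k) \<xi>" for \<xi>
    proof (cases "\<xi> \<ge> 0")
      case True
      then have "exp (- \<xi>) * exp (- \<xi>) \<le> exp (- \<xi>) * 1" by (intro mult_left_mono) auto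
      then have "\<xi> ^ (2 * k) * (exp (- \<xi>) * exp (- \<xi>)) \<le> \<xi> ^ (2 * k) * exp (- \<xi>)"
        by (intro mult_left_mono) auto
      then show ?thesis using True
        by (simp add: laguerre_weight_def power2_eq_square power_mult power_mult_distrib mult_ac)
    qed (simp add: laguerre_weight_def)
    then show "AE \<xi> in lborel. norm ((norm (complex_of_real (laguerre_weight k \<xi>)))\<^sup>2) \<le> norm (laguerre_weight (2 * k) \<xi>)"
      by (simp add: laguerre_weight_nonneg)
  qed simp
qed simp

text \<open>
  Integration by parts on the half-line raises the power \<open>k\<close> by one at a time. The boundary term
  at 0 is present only for \<open>k = 0\<close>.
\<close>

lemma fourier_laguerre_weight:
  "(LINT \<xi>|lborel. exp (- \<i> * of_real (\<xi> * x)) * of_real (laguerre_weight k \<xi>)) = fact k * pole x ^ (k + 1)"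
proof -
  let ?a = "1 + \<i> * of_real x"
  let ?L = "\<lambda>k \<xi>. of_real (\<xi> ^ k) * exp (- (?a * of_real \<xi>))"
  define L where "L k = (LINT \<xi>|lborel. indicat_real {0..} \<xi> *\<^sub>R ?L k \<xi>)" for k
  have L_eq: "(LINT \<xi>|lborel. exp (- \<i> * of_real (\<xi> * x)) * of_real (laguerre_weight k \<xi>)) = L k" for k
    unfolding L_def laguerre_weight_def
    by (intro Bochner_Integration.integral_cong)
       (auto simp: indicator_def algebra_simps exp_add[symmetric] exp_of_real[symmetric] simp flip: exp_minus)
  have nL: "norm (indicat_real {0..} \<xi> *\<^sub>R ?L k \<xi>) = laguerre_weight k \<xi>" for k \<xi>
    by (auto simp: laguerre_weight_def norm_mult indicator_def norm_exp norm_power)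
  have I: "integrable lborel (\<lambda>\<xi>. indicat_real {0..} \<xi> *\<^sub>R ?L k \<xi>)" for k
  proof (rule Bochner_Integration.integrable_bound[OF integrable_laguerre_weight[of k]])
    show "AE \<xi> in lborel. norm (indicat_real {0..} \<xi> *\<^sub>R ?L k \<xi>) \<le> norm (laguerre_weight k \<xi>)"
      unfolding nL by simp
  qed measurable
  \<comment> \<open>The interval integral of the fundamental theorem runs over the open half-line.\<close>
  have ae: "AE \<xi> in lborel. indicat_real {0<..} \<xi> = indicat_real {0..} (\<xi> :: real)"
    using AE_lborel_singleton[of 0] by eventually_elim (auto simp: indicator_def)
  have lim0: "(?L k \<longlongrightarrow> 0) at_top" for k
  proof (rule Lim_null_comparison)
    have e: "norm (exp (- (?a * of_real \<xi>))) = inverse (exp \<xi>)" for \<xi>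
      by (simp add: norm_exp flip: exp_minus)
    show "eventually (\<lambda>\<xi>. norm (?L k \<xi>) \<le> \<xi> ^ k / exp \<xi>) at_top"
      using eventually_ge_at_top[of 0]
      by eventually_elim (simp only: norm_mult norm_power norm_of_real e divide_inverse abs_of_nonneg zero_le_power order_refl)
  qed (rule tendsto_power_div_exp_0)
  have FTC: "(LINT \<xi>|lborel. indicat_real {0..} \<xi> *\<^sub>R f \<xi>) = - (if k = 0 then 1 else 0)"
    if f: "\<And>\<xi>. (?L k has_vector_derivative f \<xi>) (at \<xi>)" and c: "continuous_on UNIV f"
      and i: "integrable lborel (\<lambda>\<xi>. indicat_real {0..} \<xi> *\<^sub>R f \<xi>)" for k f
  proof -
    have [measurable]: "f \<in> borel_measurable borel" using c by (rule borel_measurable_continuous_onI)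
    have "(LBINT \<xi>=0..\<infinity>. f \<xi>) = 0 - ?L k 0"
    proof (rule interval_integral_FTC_integrable[OF _ f])
      show "isCont f \<xi>" for \<xi> using c by (simp add: continuous_on_eq_continuous_at)
      show "set_integrable lborel (einterval 0 \<infinity>) f"
        unfolding set_integrable_def zero_ereal_def einterval_eq
        by (rule integrable_cong_AE_imp[OF i]) (use ae in \<open>auto elim!: eventually_mono\<close>)
      have "isCont (?L k) 0" by (intro continuous_intros)
      then have "(?L k \<longlongrightarrow> ?L k 0) (at_right 0)"
        by (rule filterlim_mono[OF isContD order_refl]) (simp add: at_le)
      then show "((?L k \<circ> real_of_ereal) \<longlongrightarrow> ?L k 0) (at_right 0)"
        unfolding zero_ereal_def ereal_tendsto_simps .
      show "((?L k \<circ> real_of_ereal) \<longlongrightarrow> 0) (at_left \<infinity>)"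
        unfolding ereal_tendsto_simps by (rule lim0)
    qed simp
    moreover have "(LBINT \<xi>=0..\<infinity>. f \<xi>) = (LINT \<xi>|lborel. indicat_real {0..} \<xi> *\<^sub>R f \<xi>)"
      unfolding interval_lebesgue_integral_def set_lebesgue_integral_def zero_ereal_def einterval_eq
      using ae by (auto intro!: integral_cong_AE elim!: eventually_mono)
    ultimately show ?thesis by (cases "k = 0") auto
  qed
  have "L k = fact k / ?a ^ (k + 1)"
  proof (induction k)
    case 0
    have "(LINT \<xi>|lborel. indicat_real {0..} \<xi> *\<^sub>R (- ?a * ?L 0 \<xi>)) = - (if (0::nat) = 0 then 1 else 0)"
    proof (rule FTC)
      show "(?L 0 has_vector_derivative (- ?a * ?L 0 \<xi>)) (at \<xi>)" for \<xi>
        by (auto intro!: derivative_eq_intros has_vector_derivative_real_field simp: algebra_simps)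
      show "continuous_on UNIV (\<lambda>\<xi>. - ?a * ?L 0 \<xi>)" by (intro continuous_intros)
      show "integrable lborel (\<lambda>\<xi>. indicat_real {0..} \<xi> *\<^sub>R (- ?a * ?L 0 \<xi>))"
        using integrable_mult_right[OF I, of "- ?a" 0] by (simp add: mult_ac scaleR_conv_of_real)
    qed
    moreover have "(LINT \<xi>|lborel. indicat_real {0..} \<xi> *\<^sub>R (- ?a * ?L 0 \<xi>)) = - ?a * L 0"
      unfolding L_def integral_mult_right_zero[symmetric] by (simp add: scaleR_conv_of_real mult_ac)
    ultimately have "- ?a * L 0 = - 1" by (simp only: if_True refl)
    then have "?a * L 0 = 1" by (simp only: mult_minus_left neg_equal_iff_equal)
    then show ?case by (simp add: field_simps)
  next
    case (Suc k)
    let ?f = "\<lambda>\<xi>. of_nat (Suc k) * ?L k \<xi> - ?a * ?L (Suc k) \<xi>"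
    have i: "has_bochner_integral lborel (\<lambda>\<xi>. of_nat (Suc k) * (indicat_real {0..} \<xi> *\<^sub>R ?L k \<xi>)
        - ?a * (indicat_real {0..} \<xi> *\<^sub>R ?L (Suc k) \<xi>)) (of_nat (Suc k) * L k - ?a * L (Suc k))"
      unfolding L_def
      by (intro has_bochner_integral_diff has_bochner_integral_mult_right has_bochner_integral_integrable I)
    have e: "(\<lambda>\<xi>. of_nat (Suc k) * (indicat_real {0..} \<xi> *\<^sub>R ?L k \<xi>)
        - ?a * (indicat_real {0..} \<xi> *\<^sub>R ?L (Suc k) \<xi>)) = (\<lambda>\<xi>. indicat_real {0..} \<xi> *\<^sub>R ?f \<xi>)"
      by (simp add: fun_eq_iff scaleR_conv_of_real algebra_simps)
    note i = i[unfolded e]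
    have "(LINT \<xi>|lborel. indicat_real {0..} \<xi> *\<^sub>R ?f \<xi>) = - (if Suc k = 0 then 1 else 0)"
    proof (rule FTC)
      show "(?L (Suc k) has_vector_derivative ?f \<xi>) (at \<xi>)" for \<xi>
        unfolding of_real_power
        by (rule has_vector_derivative_real_field, auto intro!: derivative_eq_intros simp: algebra_simps)
           (metis Suc_pred gr0I power_Suc)
      show "continuous_on UNIV ?f" by (intro continuous_intros)
    qed (use i in \<open>auto simp: has_bochner_integral_iff\<close>)
    then have "of_nat (Suc k) * L k = ?a * L (Suc k)"
      using has_bochner_integral_integral_eq[OF i] by simp
    then have "L (Suc k) = of_nat (Suc k) * L k / ?a" by (simp add: field_simps)
    then show ?case unfolding Suc.IH by (simp add: field_simps)
  qed
  then show ?thesis unfolding L_eq pole_def by (simp add: power_divide)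
qed


lemma pole_measurable [measurable]: "pole \<in> borel_measurable borel"
  unfolding pole_def by measurable

lemma norm_pole_sq: "(norm (pole x))\<^sup>2 = rho x / 2"
  by (simp add: pole_def norm_divide power_divide cmod_power2 rho_def add_nonneg_eq_0_iff field_simps)

lemma norm_pole_le_1: "norm (pole x) \<le> 1"
proof -
  have "(norm (pole x))\<^sup>2 \<le> 1" unfolding norm_pole_sq rho_def by (simp add: divide_le_eq add_pos_nonneg)
  then show ?thesis by (simp add: power_le_one_iff abs_square_le_1[symmetric] del: power_mono_iff)
qed

lemma L2_pole_mult:
  assumes c: "b \<in> borel_measurable borel" and b: "\<And>x. norm (b x) \<le> B"
  shows "L2_fun (\<lambda>x. pole x * b x)"
  unfolding L2_fun_def
proof
  show "integrable lborel (\<lambda>x. (norm (pole x * b x))\<^sup>2)"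
  proof (rule Bochner_Integration.integrable_bound)
    show "integrable lborel (\<lambda>x. B\<^sup>2 * rho x)" using integrable_rho by simp
    show "(\<lambda>x. (norm (pole x * b x))\<^sup>2) \<in> borel_measurable lborel" using c by measurable
    have "(norm (pole x * b x))\<^sup>2 \<le> B\<^sup>2 * rho x" for x
    proof -
      have "(norm (b x))\<^sup>2 \<le> B\<^sup>2" by (intro power_mono b) simp
      then have "(norm (pole x * b x))\<^sup>2 \<le> rho x / 2 * B\<^sup>2"
        unfolding norm_mult power_mult_distrib norm_pole_sq by (intro mult_left_mono) auto
      also have "\<dots> \<le> B\<^sup>2 * rho x" by (simp add: mult_ac)
      finally show ?thesis .
    qed
    then show "AE x in lborel. norm ((norm (pole x * b x))\<^sup>2) \<le> norm (B\<^sup>2 * rho x)"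
      by (auto simp: abs_of_nonneg)
  qed
qed (use c in measurable)

lemma L2_pole_power: "L2_fun (\<lambda>x. pole x ^ Suc k)"
  unfolding power_Suc
  by (rule L2_pole_mult[where B = 1]) (auto simp: norm_power norm_pole_le_1 power_le_one)

lemma L2_fun_cmult: "L2_fun u \<Longrightarrow> L2_fun (\<lambda>x. c * u x)"
  by (auto simp: L2_fun_def norm_mult power_mult_distrib)

text \<open>
  Multiplication by \<open>|\<xi>|\<close> turns \<open>laguerre_weight k\<close> into \<open>laguerre_weight (Suc k)\<close>.
\<close>

lemma abs_nabla_pole_power:
  assumes "abs_nabla u h"
  shows "(LINT x|lborel. h x * pole x ^ Suc k) = (LINT x|lborel. u x * (of_nat (Suc k) * pole x ^ Suc (Suc k)))"
proof -
  obtain U where uU: "L2_fourier u U" and hU: "L2_fourier h (\<lambda>\<xi>. of_real \<bar>\<xi>\<bar> * U \<xi>)"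
    using assms by (auto simp: abs_nabla_def)
  have W: "L2_fun (\<lambda>x. fact k * pole x ^ (k + 1))" for k
    using L2_fun_cmult[OF L2_pole_power] by simp
  have i: "integrable lborel (\<lambda>\<xi>. complex_of_real (laguerre_weight k \<xi>))" for k
    using integrable_laguerre_weight by simp
  note pair = L2_fourier_pairing[OF _ i L2_laguerre_weight fourier_laguerre_weight[symmetric] W]
  have "fact k * (LINT x|lborel. h x * pole x ^ Suc k) = (LINT x|lborel. h x * (fact k * pole x ^ (k + 1)))"
    unfolding integral_mult_right_zero[symmetric] by (simp add: mult_ac)
  also have "\<dots> = (LINT \<xi>|lborel. of_real \<bar>\<xi>\<bar> * U \<xi> * of_real (laguerre_weight k \<xi>))"
    by (rule pair[OF hU, symmetric])
  also have "\<dots> = (LINT \<xi>|lborel. U \<xi> * of_real (laguerre_weight (Suc k) \<xi>))"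
    by (intro Bochner_Integration.integral_cong)
       (auto simp: laguerre_weight_def indicator_def)
  also have "\<dots> = (LINT x|lborel. u x * (fact (Suc k) * pole x ^ (Suc k + 1)))"
    by (rule pair[OF uU])
  also have "\<dots> = fact k * (LINT x|lborel. u x * (of_nat (Suc k) * pole x ^ Suc (Suc k)))"
    unfolding integral_mult_right_zero[symmetric] by (simp add: mult_ac)
  finally show ?thesis by simp
qed

text \<open>
  By linearity, \<open>|\<nabla>|\<close> maps \<open>q(s)\<close> to \<open>s\<^sup>2 q'(s)\<close> for every polynomial \<open>q\<close> without constant term,
  where \<open>s\<close> is \<open>pole\<close>.
\<close>

lemma abs_nabla_poly_pole:
  assumes hu: "abs_nabla u h" and q0: "coeff q 0 = 0"
  shows "(LINT x|lborel. h x * poly q (pole x)) = (LINT x|lborel. u x * ((pole x)\<^sup>2 * poly (pderiv q) (pole x)))"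
proof -
  have L2: "L2_fun u" "L2_fun h" using hu by (auto simp: abs_nabla_def L2_fourier_def)
  have qs: "q = (\<Sum>i<degree q. monom (coeff q (Suc i)) (Suc i))"
    using poly_as_sum_of_monoms[of q] q0 unfolding lessThan_Suc_atMost[symmetric]
    by (subst (asm) sum.lessThan_Suc_shift) simp
  have p1: "poly q s = (\<Sum>i<degree q. coeff q (Suc i) * s ^ Suc i)" for s
    by (subst qs) (simp add: poly_sum poly_monom)
  have pd: "pderiv (\<Sum>i<n. r i) = (\<Sum>i<n. pderiv (r i))" for r :: "nat \<Rightarrow> complex poly" and n
    by (induction n) (auto simp: pderiv_add)
  have p2: "s\<^sup>2 * poly (pderiv q) s = (\<Sum>i<degree q. coeff q (Suc i) * (of_nat (Suc i) * s ^ Suc (Suc i)))" for s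
    by (subst qs)
       (simp add: poly_sum poly_monom pd pderiv_monom sum_distrib_left power2_eq_square mult_ac)
  have i: "integrable lborel (\<lambda>x. v x * pole x ^ Suc k)" if "L2_fun v" for v k
    by (rule integrable_L2_mult[OF that L2_pole_power])
  have sum_integral: "(LINT x|lborel. v x * (\<Sum>i<n. c i * (b i * pole x ^ Suc (k i))))
      = (\<Sum>i<n. c i * (LINT x|lborel. v x * (b i * pole x ^ Suc (k i))))"
    if v: "L2_fun v" for v c b n and k :: "nat \<Rightarrow> nat"
  proof -
    have "v x * (\<Sum>i<n. c i * (b i * pole x ^ Suc (k i))) = (\<Sum>i<n. (c i * b i) * (v x * pole x ^ Suc (k i)))" for x
      unfolding sum_distrib_left by (intro sum.cong) (auto simp: mult_ac)
    moreover have "(LINT x|lborel. v x * (b i * pole x ^ Suc (k i))) = b i * (LINT x|lborel. v x * pole x ^ Suc (k i))" for i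
      unfolding integral_mult_right_zero[symmetric] by (simp add: mult_ac)
    ultimately show ?thesis using i[OF v] by (simp add: mult.assoc del: power_Suc)
  qed
  have "(LINT x|lborel. h x * poly q (pole x))
      = (\<Sum>i<degree q. coeff q (Suc i) * (LINT x|lborel. h x * pole x ^ Suc i))"
    unfolding p1 using sum_integral[OF L2(2), of _ "\<lambda>_. 1" "\<lambda>i. i"] by (simp del: power_Suc)
  also have "\<dots> = (\<Sum>i<degree q. coeff q (Suc i) * (LINT x|lborel. u x * (of_nat (Suc i) * pole x ^ Suc (Suc i))))"
    unfolding abs_nabla_pole_power[OF hu] ..
  also have "\<dots> = (LINT x|lborel. u x * ((pole x)\<^sup>2 * poly (pderiv q) (pole x)))"
    unfolding p2 using sum_integral[OF L2(1), of _ "\<lambda>i. of_nat (Suc i)" Suc] by (simp del: power_Suc of_nat_Suc)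
  finally show ?thesis .
qed

section \<open>Coefficients of eigenfunctions\<close>

lemma inverse_cay_eq_pole: "inverse (cay x) = 2 * pole x - 1"
  using one_plus_cay_inverse[of x] by (simp add: pole_def algebra_simps)

lemma pole_sq: "(pole x)\<^sup>2 = of_real (rho x) * inverse (cay x) / 2"
proof -
  have "(1 / a)\<^sup>2 = 2 / (a * b) * inverse (a / b) / 2" if "a \<noteq> 0" "b \<noteq> 0" for a b :: complex
    using that by (simp add: field_simps power2_eq_square)
  from this[of "1 + \<i> * of_real x" "1 - \<i> * of_real x"] show ?thesis
    unfolding rho_eq cay_def pole_def by (simp only: one_plus_ii_ne not_False_eq_True simp_thms)
qed

lemma integrable_L2_rho:
  assumes "L2_fun (\<lambda>x. of_real (v x))"
  shows "v \<in> borel_measurable borel" "integrable lborel (\<lambda>x. (v x)\<^sup>2)" "integrable lborel (\<lambda>x. (v x)\<^sup>2 * rho x)"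
    "integrable lborel (\<lambda>x. v x * rho x)"
proof -
  have "(\<lambda>x. Re (complex_of_real (v x))) \<in> borel_measurable borel"
    using assms unfolding L2_fun_def by (intro measurable_compose[OF _ borel_measurable_Re]) auto
  then show vm: "v \<in> borel_measurable borel" by simp
  show v2: "integrable lborel (\<lambda>x. (v x)\<^sup>2)" using assms by (simp add: L2_fun_def)
  have r2: "rho x \<le> 2" for x by (simp add: rho_def divide_le_eq add_pos_nonneg)
  show "integrable lborel (\<lambda>x. (v x)\<^sup>2 * rho x)"
  proof (rule Bochner_Integration.integrable_bound)
    show "integrable lborel (\<lambda>x. (v x)\<^sup>2 * 2)" using v2 by simp
    show "AE x in lborel. norm ((v x)\<^sup>2 * rho x) \<le> norm ((v x)\<^sup>2 * 2)"
      using r2 by (auto simp: abs_mult intro!: mult_left_mono)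
  qed (use vm in measurable)
  then show "integrable lborel (\<lambda>x. v x * rho x)" by (rule integrable_weighted_of_square[OF vm])
qed

lemma eigen_L2:
  assumes "Lplus m (\<lambda>x. of_real (v x)) w"
  shows "L2_fun (\<lambda>x. complex_of_real (v x))"
  using assms by (auto simp: Lplus_def abs_nabla_def L2_fourier_def)

text \<open>
  The eigenvalue equation in weak form. The potential \<open>2 m / (1 + x\<^sup>2)\<close> is \<open>m rho\<close>.
\<close>

lemma eigen_poly_identity:
  assumes ef: "Lplus m (\<lambda>x. of_real (v x)) (\<lambda>x. of_real E * of_real (v x))" and q0: "coeff q 0 = 0"
  shows "(LINT x|lborel. of_real ((E + real m * rho x) * v x) * poly q (pole x))
       = (LINT x|lborel. of_real (v x) * ((pole x)\<^sup>2 * poly (pderiv q) (pole x)))"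
proof -
  obtain h where hu: "abs_nabla (\<lambda>x. of_real (v x)) h"
    and h: "AE x in lborel. of_real E * of_real (v x) = h x - of_real (2 * real m / (1 + x\<^sup>2)) * of_real (v x)"
    using ef by (auto simp: Lplus_def)
  have "(\<lambda>x. complex_of_real (v x)) \<in> borel_measurable borel" "h \<in> borel_measurable borel"
    using hu by (auto simp: abs_nabla_def L2_fourier_def L2_fun_def)
  then have [measurable]: "v \<in> borel_measurable borel" "h \<in> borel_measurable borel"
    using measurable_compose[OF _ borel_measurable_Re, of "\<lambda>x. complex_of_real (v x)" borel] by simp_all
  have [measurable]: "poly q \<in> borel_measurable borel"
    by (intro borel_measurable_continuous_onI continuous_intros)
  have "(LINT x|lborel. of_real ((E + real m * rho x) * v x) * poly q (pole x))
     = (LINT x|lborel. h x * poly q (pole x))"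
  proof (rule integral_cong_AE)
    show "AE x in lborel. of_real ((E + real m * rho x) * v x) * poly q (pole x) = h x * poly q (pole x)"
      using h
    proof eventually_elim
      case (elim x)
      then have "h x = of_real E * of_real (v x) + of_real (2 * real m / (1 + x\<^sup>2)) * of_real (v x)"
        by (simp only: diff_add_cancel)
      moreover have "2 * real m / (1 + x\<^sup>2) = real m * rho x" by (simp add: rho_def)
      ultimately have "h x = of_real ((E + real m * rho x) * v x)"
        by (simp only: of_real_mult of_real_add distrib_right)
      then show ?case by simp
    qed
  qed measurable
  then show ?thesis using abs_nabla_poly_pole[OF hu q0] by simp
qed

text \<open>
  The test polynomial is \<open>s\<^sup>2 (2 s - 1)\<^sup>n\<close>: by \<open>pole_sq\<close> and \<open>inverse_cay_eq_pole\<close> it equals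
  \<open>rho \<zeta>\<^sup>-\<^sup>n\<^sup>-\<^sup>1 / 2\<close>, so that pairing with it produces a coefficient.
\<close>

lemma eigen_recurrence_pos:
  fixes c :: "int \<Rightarrow> complex"
  assumes ef: "Lplus m (\<lambda>x. of_real (v x)) (\<lambda>x. of_real E * of_real (v x))"
  defines "c \<equiv> circle_coeff v"
  shows "2 * of_real E * c (- int (Suc n)) = (real n - real m) * c (- int n)
           + 2 * (real (Suc n) - real m) * c (- int (Suc n)) + (real (Suc (Suc n)) - real m) * c (- int (Suc (Suc n)))"
proof -
  note L2 = eigen_L2[OF ef]
  note vr = integrable_L2_rho[OF L2]
  define t where "t x = inverse (cay x)" for x
  define b where "b k x = of_real (v x * rho x) * t x ^ k" for k x
  have b: "has_bochner_integral lborel (b k) (c (- int k))" for k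
  proof -
    have "b k = (\<lambda>x. of_real (v x * rho x) * cay x powi (- int k))"
      by (simp add: b_def t_def fun_eq_iff power_int_minus power_inverse)
    then show ?thesis unfolding c_def circle_coeff_def
      using has_bochner_integral_integrable[OF integrable_weighted_cay_powi[OF vr(4)]] by simp
  qed
  let ?q = "[:0, 0, 1:] * [:-1, 2:] ^ n :: complex poly"
  have pole_t: "pole x = (1 + t x) / 2" for x using inverse_cay_eq_pole[of x] by (simp add: t_def)
  have t: "2 * pole x - 1 = t x" for x using inverse_cay_eq_pole[of x] by (simp add: t_def)
  have p2: "(pole x)\<^sup>2 = of_real (rho x) * t x / 2" for x by (simp add: pole_sq t_def)
  have rp2: "of_real (rho x) * (pole x)\<^sup>2 = of_real (rho x) * (1 + 2 * t x + (t x)\<^sup>2) / 4" for x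
    by (simp add: pole_t power2_eq_square algebra_simps)
  have q: "poly ?q (pole x) = (pole x)\<^sup>2 * t x ^ n" for x
    by (simp add: t[symmetric] power2_eq_square algebra_simps)
  have l: "of_real ((E + real m * rho x) * v x) * poly ?q (pole x)
      = of_real (E / 2) * b (Suc n) x + of_real (real m / 4) * (b n x + 2 * b (Suc n) x + b (Suc (Suc n)) x)" for x
  proof -
    have "of_real ((E + real m * rho x) * v x) * poly ?q (pole x)
      = of_real (v x) * (of_real E * (pole x)\<^sup>2 + of_real (real m) * (of_real (rho x) * (pole x)\<^sup>2)) * t x ^ n"
      unfolding q by (simp add: algebra_simps)
    also have "\<dots> = of_real (v x) * (of_real E * (of_real (rho x) * t x / 2)
        + of_real (real m) * (of_real (rho x) * (1 + 2 * t x + (t x)\<^sup>2) / 4)) * t x ^ n"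
      by (simp only: rp2) (simp only: p2)
    also have "\<dots> = of_real (E / 2) * b (Suc n) x + of_real (real m / 4) * (b n x + 2 * b (Suc n) x + b (Suc (Suc n)) x)"
      by (simp add: b_def algebra_simps power2_eq_square add_divide_distrib)
    finally show ?thesis .
  qed
  have r: "of_real (v x) * ((pole x)\<^sup>2 * poly (pderiv ?q) (pole x))
      = of_real (1/2) * (b (Suc n) x + b (Suc (Suc n)) x) + of_real (real n / 4) * (b n x + 2 * b (Suc n) x + b (Suc (Suc n)) x)" for x
  proof (cases n)
    case 0
    have "of_real (v x) * ((pole x)\<^sup>2 * poly (pderiv ?q) (pole x)) = of_real (v x) * ((pole x)\<^sup>2 * (2 * pole x))"
      using 0 by (simp add: pderiv_pCons algebra_simps)
    also have "\<dots> = of_real (v x * rho x) * t x / 2 * (1 + t x)"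
      unfolding p2 by (simp add: pole_t)
    finally show ?thesis using 0 by (simp add: b_def field_simps power2_eq_square)
  next
    case (Suc k)
    have "poly (pderiv ?q) (pole x) = 2 * pole x * t x ^ n + (pole x)\<^sup>2 * (of_nat n * t x ^ k * 2)"
      unfolding pderiv_mult Suc pderiv_power_Suc
      by (simp add: pderiv_pCons t[symmetric] power2_eq_square algebra_simps)
    also have "\<dots> = (1 + t x) * t x ^ n + of_nat n * (1 + t x)\<^sup>2 / 2 * t x ^ k"
      by (simp add: pole_t power2_eq_square field_simps)
    finally have "of_real (v x) * ((pole x)\<^sup>2 * poly (pderiv ?q) (pole x))
      = of_real (v x) * (of_real (rho x) * t x / 2 * ((1 + t x) * t x ^ n + of_nat n * (1 + t x)\<^sup>2 / 2 * t x ^ k))"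
      unfolding p2 by simp
    also have "\<dots> = of_real (1/2) * (b (Suc n) x + b (Suc (Suc n)) x) + of_real (real n / 4) * (b n x + 2 * b (Suc n) x + b (Suc (Suc n)) x)"
      unfolding Suc by (simp add: b_def field_simps power2_eq_square)
    finally show ?thesis .
  qed
  have q0: "coeff ?q 0 = 0" by (simp add: coeff_mult)
  have "of_real (E / 2) * c (- int (Suc n)) + of_real (real m / 4) * (c (- int n) + 2 * c (- int (Suc n)) + c (- int (Suc (Suc n))))
      = of_real (1/2) * (c (- int (Suc n)) + c (- int (Suc (Suc n)))) + of_real (real n / 4) * (c (- int n) + 2 * c (- int (Suc n)) + c (- int (Suc (Suc n))))"
  proof -
    have "(LINT x|lborel. of_real ((E + real m * rho x) * v x) * poly ?q (pole x))
       = of_real (E / 2) * c (- int (Suc n)) + of_real (real m / 4) * (c (- int n) + 2 * c (- int (Suc n)) + c (- int (Suc (Suc n))))"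
      unfolding l
      by (rule has_bochner_integral_integral_eq)
         (intro has_bochner_integral_add has_bochner_integral_mult_right b)
    moreover have "(LINT x|lborel. of_real (v x) * ((pole x)\<^sup>2 * poly (pderiv ?q) (pole x)))
       = of_real (1/2) * (c (- int (Suc n)) + c (- int (Suc (Suc n)))) + of_real (real n / 4) * (c (- int n) + 2 * c (- int (Suc n)) + c (- int (Suc (Suc n))))"
      unfolding r
      by (rule has_bochner_integral_integral_eq)
         (intro has_bochner_integral_add has_bochner_integral_mult_right b)
    ultimately show ?thesis using eigen_poly_identity[OF ef q0] by simp
  qed
  note eq = this
  let ?S = "c (- int n) + 2 * c (- int (Suc n)) + c (- int (Suc (Suc n)))"
  have "2 * of_real E * c (- int (Suc n))
      = 4 * (of_real (E / 2) * c (- int (Suc n)) + of_real (real m / 4) * ?S) - of_real (real m) * ?S"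
    by (simp add: algebra_simps)
  also have "\<dots> = 4 * (of_real (1/2) * (c (- int (Suc n)) + c (- int (Suc (Suc n)))) + of_real (real n / 4) * ?S)
      - of_real (real m) * ?S"
    unfolding eq ..
  also have "\<dots> = (real n - real m) * c (- int n)
      + 2 * (real (Suc n) - real m) * c (- int (Suc n)) + (real (Suc (Suc n)) - real m) * c (- int (Suc (Suc n)))"
    by (simp add: algebra_simps)
  finally show ?thesis .
qed

text \<open>
  The middle equation involves both half-lines of frequencies. It is the real part of the equation
  tested with \<open>s\<close>, since \<open>s + cnj s = rho\<close>.
\<close>

lemma eigen_recurrence_0:
  assumes ef: "Lplus m (\<lambda>x. of_real (v x)) (\<lambda>x. of_real E * of_real (v x))"
  shows "2 * of_real E * circle_coeff v 0 = (1 - real m) * circle_coeff v 1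
           - 2 * real m * circle_coeff v 0 + (1 - real m) * circle_coeff v (- 1)"
proof -
  note L2 = eigen_L2[OF ef]
  note vr = integrable_L2_rho[OF L2]
  let ?c = "circle_coeff v"
  have b: "has_bochner_integral lborel (\<lambda>x. of_real (v x * rho x) * cay x powi p) (?c p)" for p
    unfolding circle_coeff_def
    by (rule has_bochner_integral_integrable[OF integrable_weighted_cay_powi[OF vr(4)]])
  let ?q = "[:0, 1:] :: complex poly"
  have c0: "?c 0 = cnj (?c 0)" using circle_coeff_uminus[of v 0] by simp
  have c1: "?c 1 = cnj (?c (- 1))" using circle_coeff_uminus[of v "- 1"] by simp
  define s where "s = (LINT x|lborel. of_real (v x) * pole x)"
  have "integrable lborel (\<lambda>x. of_real (v x) * pole x)"
    using integrable_L2_mult[OF L2 L2_pole_power[of 0]] by simp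
  then have s: "has_bochner_integral lborel (\<lambda>x. of_real (v x) * pole x) s"
    unfolding s_def by (rule has_bochner_integral_integrable)
  have l: "of_real ((E + real m * rho x) * v x) * poly ?q (pole x)
      = of_real E * (of_real (v x) * pole x)
         + of_real (real m / 2) * (of_real (v x * rho x) * cay x powi 0 + of_real (v x * rho x) * cay x powi (-1))" for x
  proof -
    have pl: "pole x = (1 + inverse (cay x)) / 2" using inverse_cay_eq_pole[of x] by simp
    have "of_real ((E + real m * rho x) * v x) * poly ?q (pole x) = of_real E * (of_real (v x) * pole x)
        + of_real (real m * rho x * v x) * pole x"
      by (simp add: algebra_simps)
    also have "of_real (real m * rho x * v x) * pole x
       = of_real (real m / 2) * (of_real (v x * rho x) * cay x powi 0 + of_real (v x * rho x) * cay x powi (-1))"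
      unfolding pl by (simp add: algebra_simps add_divide_distrib)
    finally show ?thesis .
  qed
  have r: "of_real (v x) * ((pole x)\<^sup>2 * poly (pderiv ?q) (pole x)) = of_real (1/2) * (of_real (v x * rho x) * cay x powi (-1))" for x
    unfolding pole_sq by (simp add: pderiv_pCons)
  have eq: "of_real E * s + of_real (real m / 2) * (?c 0 + ?c (-1)) = of_real (1/2) * ?c (-1)"
  proof -
    have "(LINT x|lborel. of_real ((E + real m * rho x) * v x) * poly ?q (pole x))
      = of_real E * s + of_real (real m / 2) * (?c 0 + ?c (-1))"
      unfolding l
      by (rule has_bochner_integral_integral_eq)
         (intro has_bochner_integral_add has_bochner_integral_mult_right b s)
    moreover have "(LINT x|lborel. of_real (v x) * ((pole x)\<^sup>2 * poly (pderiv ?q) (pole x))) = of_real (1/2) * ?c (-1)"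
      unfolding r
      by (rule has_bochner_integral_integral_eq)
         (intro has_bochner_integral_add has_bochner_integral_mult_right b)
    ultimately show ?thesis using eigen_poly_identity[OF ef, of ?q] by simp
  qed
  have "s + cnj s = ?c 0"
  proof -
    have p: "pole x + cnj (pole x) = of_real (rho x)" for x
      unfolding pole_def rho_eq by (simp add: field_simps)
    have "has_bochner_integral lborel (\<lambda>x. of_real (v x) * pole x + cnj (of_real (v x) * pole x)) (s + cnj s)"
      by (intro has_bochner_integral_add has_bochner_integral_cnj s)
    moreover have "of_real (v x) * pole x + cnj (of_real (v x) * pole x) = of_real (v x * rho x) * cay x powi 0" for x
      using arg_cong[OF p[of x], of "\<lambda>z. of_real (v x) * z"] by (simp add: algebra_simps)
    ultimately show ?thesis using b[of 0] has_bochner_integral_eq by fastforce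
  qed
  note sc = this
  have "cnj (of_real E * s + of_real (real m / 2) * (?c 0 + ?c (-1))) = cnj (of_real (1/2) * ?c (-1))"
    using eq by (rule arg_cong)
  then have eq': "of_real E * cnj s + of_real (real m / 2) * (?c 0 + ?c 1) = of_real (1/2) * ?c 1"
    using c0 c1 by simp
  have "2 * of_real E * ?c 0 = 2 * ((of_real E * s + of_real (real m / 2) * (?c 0 + ?c (-1)))
      + (of_real E * cnj s + of_real (real m / 2) * (?c 0 + ?c 1))) - of_real (real m) * (2 * ?c 0 + ?c (-1) + ?c 1)"
    unfolding sc[symmetric] by (simp add: algebra_simps)
  also have "\<dots> = 2 * (of_real (1/2) * ?c (-1) + of_real (1/2) * ?c 1) - of_real (real m) * (2 * ?c 0 + ?c (-1) + ?c 1)"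
    unfolding eq eq' ..
  also have "\<dots> = (1 - real m) * ?c 1 - 2 * real m * ?c 0 + (1 - real m) * ?c (- 1)"
    by (simp add: algebra_simps)
  finally show ?thesis .
qed

text \<open>
  On the circle the eigenvalue equation reads \<open>(1 + cos \<theta>) (|D| - m) v = E v\<close> with
  \<open>D = -i d/d\<theta>\<close>, and this is its form on Fourier coefficients.
\<close>

lemma eigen_recurrence:
  fixes d :: "int \<Rightarrow> complex"
  assumes ef: "Lplus m (\<lambda>x. of_real (v x)) (\<lambda>x. of_real E * of_real (v x))"
  defines "d \<equiv> \<lambda>p. of_int (\<bar>p\<bar> - int m) * circle_coeff v p"
  shows "2 * of_real E * circle_coeff v p = d (p + 1) + 2 * d p + d (p - 1)"
proof -
  have neg: "2 * of_real E * circle_coeff v p = d (p + 1) + 2 * d p + d (p - 1)" if "p < 0" for p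
  proof -
    from negD[OF that] obtain n where n: "p = - int (Suc n)" by blast
    show ?thesis using eigen_recurrence_pos[OF ef, of n] unfolding d_def n
      by (simp add: algebra_simps)
  qed
  consider "p < 0" | "p = 0" | "p > 0" by linarith
  then show ?thesis
  proof cases
    case 3
    have dc: "d (- p) = cnj (d p)" for p unfolding d_def circle_coeff_uminus by simp
    have e: "- p + 1 = - (p - 1)" "- p - 1 = - (p + 1)" by simp_all
    have "2 * of_real E * circle_coeff v (- p) = d (- p + 1) + 2 * d (- p) + d (- p - 1)"
      using 3 by (intro neg) simp
    then have "cnj (2 * of_real E * circle_coeff v p) = cnj (d (p + 1) + 2 * d p + d (p - 1))"
      unfolding e dc circle_coeff_uminus by (simp add: add_ac)
    then show ?thesis by (simp only: complex_cnj_cancel_iff)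
  qed (use neg eigen_recurrence_0[OF ef] in \<open>auto simp: d_def\<close>)
qed

text \<open>
  Since \<open>d\<close> vanishes at the index \<open>m\<close>, the recurrence beyond \<open>m\<close> starts from the single value
  \<open>d (m + 1)\<close>. For \<open>E \<le> 0\<close> its coefficient \<open>2 E / k - 2\<close> has modulus at least 2, so the increments
  of \<open>|d|\<close> do not decrease and \<open>|d|\<close> grows at least linearly. Then the coefficients of \<open>v\<close>
  stay away from 0, against Bessel's inequality, unless \<open>d (m + 1) = 0\<close>.
\<close>

lemma eigen_coeff_vanish:
  assumes ef: "Lplus m (\<lambda>x. of_real (v x)) (\<lambda>x. of_real E * of_real (v x))" and E: "E \<le> 0"
    and p: "\<bar>p\<bar> > int m"
  shows "circle_coeff v p = 0"
proof -
  note L2 = eigen_L2[OF ef]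
  note vr = integrable_L2_rho[OF L2]
  let ?c = "circle_coeff v"
  define d where "d k = of_nat k * ?c (int m + int k)" for k
  have rec: "d (Suc (Suc k)) = (2 * of_real (E / real (Suc k)) - 2) * d (Suc k) - d k" for k
  proof -
    have "2 * of_real E * ?c (int m + int (Suc k)) = d (Suc (Suc k)) + 2 * d (Suc k) + d k"
      using eigen_recurrence[OF ef, of "int m + int (Suc k)"] unfolding d_def
      by (simp add: algebra_simps)
    moreover have "2 * of_real E * ?c (int m + int (Suc k)) = 2 * of_real (E / real (Suc k)) * d (Suc k)"
      unfolding d_def by (simp del: of_nat_Suc)
    ultimately show ?thesis by (simp add: algebra_simps)
  qed
  have grow: "norm (d (Suc k)) - norm (d k) \<ge> norm (d 1)" for k
  proof (induction k)
    case 0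
    then show ?case by (simp add: d_def)
  next
    case (Suc k)
    have "norm (2 * complex_of_real (E / real (Suc k)) - 2) \<ge> 2"
    proof -
      have "2 * complex_of_real (E / real (Suc k)) - 2 = of_real (2 * (E / real (Suc k)) - 2)" by simp
      moreover have "E / real (Suc k) \<le> 0" using E by (simp add: divide_nonpos_pos)
      ultimately show ?thesis by (simp only: norm_of_real)
    qed
    then have "2 * norm (d (Suc k)) \<le> norm ((2 * of_real (E / real (Suc k)) - 2) * d (Suc k))"
      unfolding norm_mult by (intro mult_right_mono) auto
    also have "\<dots> \<le> norm (d (Suc (Suc k))) + norm (d k)"
      using norm_triangle_ineq[of "d (Suc (Suc k))" "d k"] by (simp only: rec diff_add_cancel)
    finally show ?case using Suc.IH by linarith
  qed
  have lin: "norm (d k) \<ge> real k * norm (d 1)" for k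
  proof (induction k)
    case (Suc k)
    then show ?case using grow[of k] by (simp add: algebra_simps)
  qed simp
  have "d 1 = 0"
  proof (rule ccontr)
    assume d1: "d 1 \<noteq> 0"
    have ck: "norm (?c (int m + int (Suc k))) \<ge> norm (d 1)" for k
    proof -
      have "real (Suc k) * norm (d 1) \<le> real (Suc k) * norm (?c (int m + int (Suc k)))"
        using lin[of "Suc k"] unfolding d_def[of "Suc k"] norm_mult norm_of_nat .
      then show ?thesis by (simp del: of_nat_Suc)
    qed
    define B where "B = 2 * pi * (LINT x|lborel. (v x)\<^sup>2 * rho x)"
    have "real K * (norm (d 1))\<^sup>2 \<le> B" for K
    proof -
      have "real K * (norm (d 1))\<^sup>2 = (\<Sum>k<K. (norm (d 1))\<^sup>2)" by simp
      also have "\<dots> \<le> (\<Sum>k<K. (norm (?c (int m + int (Suc k))))\<^sup>2)"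
        by (intro sum_mono power_mono ck) auto
      also have "\<dots> = (\<Sum>p\<in>(\<lambda>k. int m + int (Suc k)) ` {..<K}. (norm (?c p))\<^sup>2)"
        by (subst sum.reindex) (auto simp: inj_on_def)
      also have "\<dots> \<le> B" unfolding B_def by (rule bessel_circle_coeff[OF vr(1,3)]) auto
      finally show ?thesis .
    qed
    moreover obtain K where "real K * (norm (d 1))\<^sup>2 > B"
      using ex_less_of_nat_mult[of "(norm (d 1))\<^sup>2" B] d1 by auto
    ultimately show False by (meson not_le)
  qed
  have dz: "d k = 0 \<and> d (Suc k) = 0" for k
  proof (induction k)
    case 0
    then show ?case using \<open>d 1 = 0\<close> by (simp add: d_def)
  qed (simp add: rec)
  have pos: "?c p = 0" if "p > int m" for p
  proof -
    have "p = int m + int (nat (p - int m))" using that by simp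
    then obtain k where k: "p = int m + int k" by blast
    with that have "k > 0" by simp
    with k show ?thesis using dz[of k] by (simp add: d_def)
  qed
  show ?thesis
  proof (cases "p > 0")
    case False
    then have "?c (- p) = 0" using p by (intro pos) auto
    then show ?thesis using circle_coeff_uminus[of v p] by simp
  qed (use p pos in auto)
qed

section \<open>Completeness\<close>

text \<open>
  The functions \<open>b\<close> for which all \<open>\<zeta>\<^sup>n b\<close> are orthogonal to \<open>v rho\<close> are stable under
  multiplication by \<open>\<zeta>\<close> and its conjugate, hence by every real polynomial in them. Carrying \<open>b\<close> along
  lets the induction pass through products.
\<close>

lemma integral_polynomial_mult_zero:
  fixes q :: "complex \<Rightarrow> real"
  assumes q: "real_polynomial_function q" and v: "integrable lborel (\<lambda>x. v x * rho x)"
    and b: "b \<in> borel_measurable borel" "\<And>x. norm (b x) \<le> B"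
      "\<And>n. (LINT x|lborel. of_real (v x * rho x) * cay x powi n * b x) = 0"
  shows "(LINT x|lborel. of_real (v x * rho x) * cay x powi n * (of_real (q (cay x)) * b x)) = 0"
proof -
  have ms: "(\<lambda>x. of_real (h (cay x)) * b x) \<in> borel_measurable borel"
    if h: "real_polynomial_function h" and [measurable]: "b \<in> borel_measurable borel"
    for h :: "complex \<Rightarrow> real" and b :: "real \<Rightarrow> complex"
  proof -
    have "continuous_on UNIV (\<lambda>x. h (cay x))"
      by (rule continuous_on_compose2[OF continuous_on_polymonial_function continuous_cay])
         (use h in \<open>auto simp: real_polynomial_function_eq\<close>)
    then have [measurable]: "(\<lambda>x. h (cay x)) \<in> borel_measurable borel"
      by (rule borel_measurable_continuous_onI)
    show ?thesis by measurable
  qed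
  have bd: "\<exists>C. \<forall>x. norm (of_real (h (cay x)) * b x) \<le> C"
    if h: "real_polynomial_function h" and B: "\<And>x. norm (b x) \<le> B"
    for h :: "complex \<Rightarrow> real" and b :: "real \<Rightarrow> complex" and B
  proof -
    have "continuous_on (sphere 0 1) h"
      using h by (intro continuous_on_polymonial_function) (simp add: real_polynomial_function_eq)
    then have "bounded (h ` sphere 0 1)"
      by (intro compact_imp_bounded compact_continuous_image compact_sphere)
    then obtain K where "\<forall>y\<in>h ` sphere 0 1. norm y \<le> K"
      unfolding bounded_iff by blast
    then have K: "\<bar>h (cay x)\<bar> \<le> K" for x by simp
    have "norm (of_real (h (cay x)) * b x) \<le> K * B" for x
      unfolding norm_mult norm_of_real
      by (intro mult_mono K B order_trans[OF abs_ge_zero K]) auto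
    then show ?thesis by blast
  qed
  have vm [measurable]: "(\<lambda>x. complex_of_real (v x * rho x)) \<in> borel_measurable borel"
    using borel_measurable_integrable[OF v] by measurable
  have int: "integrable lborel (\<lambda>x. of_real (v x * rho x) * cay x powi n * b x)"
    if "b \<in> borel_measurable borel" "\<And>x. norm (b x) \<le> B" for b B n
  proof (rule Bochner_Integration.integrable_bound)
    show "integrable lborel (\<lambda>x. B * norm (v x * rho x))" using v by simp
    show "(\<lambda>x. of_real (v x * rho x) * cay x powi n * b x) \<in> borel_measurable lborel"
      using that(1) by measurable
    have "norm (complex_of_real (v x * rho x) * cay x powi n * b x) \<le> \<bar>B * norm (v x * rho x)\<bar>" for x
      using mult_right_mono[OF that(2)[of x], of "\<bar>v x * rho x\<bar>"]
      by (intro order_trans[OF _ abs_ge_self]) (simp add: norm_mult abs_mult mult_ac)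
    then show "AE x in lborel. norm (of_real (v x * rho x) * cay x powi n * b x) \<le> norm (B * norm (v x * rho x))"
      by simp
  qed
  show ?thesis using q b
  proof (induction q arbitrary: b B n rule: real_polynomial_function.induct)
    case (linear q)
    define \<alpha> where "\<alpha> = Complex (q 1) (- q \<i>) / 2"
    have q_lin: "q w = Re w * q 1 + Im w * q \<i>" for w
    proof -
      have "w = Re w *\<^sub>R 1 + Im w *\<^sub>R \<i>" by (simp add: complex_eq_iff)
      then have "q w = q (Re w *\<^sub>R 1 + Im w *\<^sub>R \<i>)" by simp
      then show ?thesis using linear.hyps by (simp add: linear_simps bounded_linear.linear linear_add linear_scale)
    qed
    have qw: "complex_of_real (q w) = \<alpha> * w + cnj \<alpha> * cnj w" for w
      by (subst q_lin) (simp add: \<alpha>_def complex_eq_iff field_simps)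
    have e: "of_real (v x * rho x) * cay x powi n * (of_real (q (cay x)) * b x)
       = \<alpha> * (of_real (v x * rho x) * cay x powi (n + 1) * b x)
         + cnj \<alpha> * (of_real (v x * rho x) * cay x powi (n - 1) * b x)" for x
    proof -
      have "cnj (cay x) = inverse (cay x)" using cnj_cay_powi[of x 1] by (simp add: power_int_minus)
      then show ?thesis unfolding qw
        by (simp add: power_int_add power_int_diff field_simps)
    qed
    show ?case unfolding e using int[OF linear.prems(1,2)] linear.prems(3) by simp
  next
    case (const c)
    have "of_real (v x * rho x) * cay x powi n * (of_real c * b x) = of_real c * (of_real (v x * rho x) * cay x powi n * b x)" for x
      by simp
    then show ?case using const.prems(3) by (simp only: integral_mult_right_zero mult_zero_right)
  next
    case (add f g)
    obtain C D where "\<And>x. norm (of_real (f (cay x)) * b x) \<le> C" "\<And>x. norm (of_real (g (cay x)) * b x) \<le> D"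
      using bd[where b = b and B = B, OF add.hyps(1) add.prems(2)] bd[where b = b and B = B, OF add.hyps(2) add.prems(2)] by metis
    note i = int[OF ms[OF add.hyps(1) add.prems(1)] this(1)] int[OF ms[OF add.hyps(2) add.prems(1)] this(2)]
    have "(LINT x|lborel. of_real (v x * rho x) * cay x powi n * (of_real (f (cay x)) * b x)
        + of_real (v x * rho x) * cay x powi n * (of_real (g (cay x)) * b x)) = 0"
      by (subst Bochner_Integration.integral_add[OF i])
         (simp only: add.IH(1)[OF add.prems] add.IH(2)[OF add.prems] add_0)
    then show ?case by (simp only: of_real_add distrib_left distrib_right)
  next
    case (mult f g)
    obtain D where D: "\<And>x. norm (of_real (g (cay x)) * b x) \<le> D"
      using bd[where b = b and B = B, OF mult.hyps(2) mult.prems(2)] by metis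
    have "(LINT x|lborel. of_real (v x * rho x) * cay x powi n * (of_real (f (cay x)) * (of_real (g (cay x)) * b x))) = 0"
      by (rule mult.IH(1)[OF ms[OF mult.hyps(2) mult.prems(1)] D]) (rule mult.IH(2)[OF mult.prems])
    then show ?case by (simp add: mult_ac)
  qed
qed

text \<open>
  Completeness of the functions \<open>\<zeta>\<^sup>n\<close>. By the Stone-Weierstrass theorem \<open>v rho\<close> annihilates every
  continuous function of \<open>\<zeta>\<close>, hence indicators of closed sets, hence indicators of Borel sets. Testing
  with the sets where \<open>v\<close> is positive or negative gives \<open>v = 0\<close>.
\<close>

theorem circle_coeff_zero_imp_AE_zero:
  assumes vm [measurable]: "v \<in> borel_measurable borel" and v: "integrable lborel (\<lambda>x. v x * rho x)"
    and c0: "\<And>n. circle_coeff v n = 0"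
  shows "AE x in lborel. v x = 0"
proof -
  have Ic: "(LINT x|lborel. v x * rho x * u (cay x)) = 0" if u: "continuous_on UNIV u" for u :: "complex \<Rightarrow> real"
  proof -
    define K where "K = (LINT x|lborel. \<bar>v x * rho x\<bar>)"
    have [measurable]: "(\<lambda>x. u (cay x)) \<in> borel_measurable borel"
      by (intro borel_measurable_continuous_onI continuous_on_compose2[OF u continuous_cay]) auto
    have "\<bar>LINT x|lborel. v x * rho x * u (cay x)\<bar> \<le> K * e" if e: "e > 0" for e
    proof -
      have "continuous_on (sphere 0 1) u" using u by (rule continuous_on_subset) simp
      then obtain q where q: "real_polynomial_function q" "\<And>w. w \<in> sphere 0 1 \<Longrightarrow> \<bar>u w - q w\<bar> < e"
        using Stone_Weierstrass_real_polynomial_function[OF compact_sphere _ e] by blast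
      have "continuous_on UNIV (\<lambda>x. q (cay x))"
        by (rule continuous_on_compose2[OF continuous_on_polymonial_function continuous_cay])
           (use q in \<open>auto simp: real_polynomial_function_eq\<close>)
      then have [measurable]: "(\<lambda>x. q (cay x)) \<in> borel_measurable borel"
        by (rule borel_measurable_continuous_onI)
      let ?d = "\<lambda>x. v x * rho x * (u (cay x) - q (cay x))"
      have d_le: "norm (?d x) \<le> \<bar>v x * rho x\<bar> * e" for x
        using q(2)[of "cay x"] unfolding real_norm_def abs_mult[of "v x * rho x"]
        by (intro mult_left_mono) auto
      have i: "integrable lborel ?d"
      proof (rule Bochner_Integration.integrable_bound)
        show "integrable lborel (\<lambda>x. \<bar>v x * rho x\<bar> * e)"
          by (intro integrable_mult_left integrable_abs v)
        show "AE x in lborel. norm (?d x) \<le> norm (\<bar>v x * rho x\<bar> * e)"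
          using order_trans[OF d_le abs_ge_self] by simp
      qed measurable
      have "bounded (q ` sphere 0 1)"
        using q(1) by (intro compact_imp_bounded compact_continuous_image compact_sphere continuous_on_polymonial_function)
          (simp add: real_polynomial_function_eq)
      then obtain B where "\<forall>y\<in>q ` sphere 0 1. norm y \<le> B"
        unfolding bounded_iff by blast
      then have B: "\<bar>q (cay x)\<bar> \<le> B" for x by simp
      have iq: "integrable lborel (\<lambda>x. v x * rho x * q (cay x))"
      proof (rule Bochner_Integration.integrable_bound)
        show "integrable lborel (\<lambda>x. \<bar>v x * rho x\<bar> * B)"
          by (intro integrable_mult_left integrable_abs v)
        have "norm (v x * rho x * q (cay x)) \<le> \<bar>v x * rho x\<bar> * B" for x
          unfolding real_norm_def abs_mult[of "v x * rho x"] by (intro mult_left_mono B) auto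
        then show "AE x in lborel. norm (v x * rho x * q (cay x)) \<le> norm (\<bar>v x * rho x\<bar> * B)"
          using order_trans[OF _ abs_ge_self] by fastforce
      qed measurable
      have "(LINT x|lborel. of_real (v x * rho x) * cay x powi 0 * (of_real (q (cay x)) * 1)) = 0"
        by (rule integral_polynomial_mult_zero[OF q(1) v, where B = 1])
           (use c0 in \<open>auto simp: circle_coeff_def\<close>)
      then have "(LINT x|lborel. complex_of_real (v x * rho x * q (cay x))) = 0" by simp
      then have "(LINT x|lborel. v x * rho x * q (cay x)) = 0"
        by (simp only: integral_complex_of_real of_real_eq_0_iff)
      moreover have "v x * rho x * u (cay x) = ?d x + v x * rho x * q (cay x)" for x
        by (simp add: algebra_simps)
      ultimately have "(LINT x|lborel. v x * rho x * u (cay x)) = (LINT x|lborel. ?d x)"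
        by (simp only: Bochner_Integration.integral_add[OF i iq])
      also have "\<bar>\<dots>\<bar> \<le> (LINT x|lborel. \<bar>v x * rho x\<bar> * e)"
        using d_le v by (intro integral_abs_bound[THEN order_trans] integral_mono) (use i in auto)
      also have "\<dots> = K * e" unfolding K_def by simp
      finally show ?thesis .
    qed
    note le = this
    have K0: "K \<ge> 0" unfolding K_def by simp
    show ?thesis
    proof (rule ccontr)
      assume n: "(LINT x|lborel. v x * rho x * u (cay x)) \<noteq> 0"
      define a where "a = \<bar>LINT x|lborel. v x * rho x * u (cay x)\<bar>"
      have a: "a > 0" using n by (simp add: a_def)
      have "a \<le> K * (a / (K + 1))" unfolding a_def[symmetric]
        using le[of "a / (K + 1)"] a K0 unfolding a_def[symmetric] by simp
      then show False using a K0 by (simp add: field_simps)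
    qed
  qed
  have I_le: "(LINT x|lborel. indicat_real C (cay x) * (v x * rho x)) = 0" if "closed C" for C
  proof (cases "C = {}")
    case False
    \<comment> \<open>Continuous functions that decrease to the indicator of the closed set.\<close>
    let ?u = "\<lambda>j w. max 0 (1 - real j * infdist w C)"
    have "(\<lambda>j. LINT x|lborel. v x * rho x * ?u j (cay x)) \<longlonglongrightarrow> (LINT x|lborel. indicat_real C (cay x) * (v x * rho x))"
    proof (rule integral_dominated_convergence[where w = "\<lambda>x. norm (v x * rho x)"])
      have [measurable]: "C \<in> sets borel" using that by measurable
      show "(\<lambda>x. indicat_real C (cay x) * (v x * rho x)) \<in> borel_measurable lborel" by measurable
      have "continuous_on UNIV (\<lambda>x. ?u j (cay x))" for j
        by (intro continuous_intros continuous_cay)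
      then have [measurable]: "(\<lambda>x. ?u j (cay x)) \<in> borel_measurable borel" for j
        by (rule borel_measurable_continuous_onI)
      show "(\<lambda>x. v x * rho x * ?u j (cay x)) \<in> borel_measurable lborel" for j by measurable
      show "integrable lborel (\<lambda>x. norm (v x * rho x))" using v by simp
      have "\<bar>?u j w\<bar> \<le> 1" for j w using infdist_nonneg[of w C] by (auto simp: max_def)
      then show "AE x in lborel. norm (v x * rho x * ?u j (cay x)) \<le> norm (v x * rho x)" for j
        unfolding norm_mult[of "v x * rho x" for x] real_norm_def[of "?u j w" for w]
        by (intro AE_I2 mult_left_le) auto
      show "AE x in lborel. (\<lambda>j. v x * rho x * ?u j (cay x)) \<longlonglongrightarrow> indicat_real C (cay x) * (v x * rho x)"
      proof (intro AE_I2)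
        fix x
        have "(\<lambda>j. ?u j (cay x)) \<longlonglongrightarrow> indicat_real C (cay x)"
        proof (cases "cay x \<in> C")
          case True
          then show ?thesis by simp
        next
          case out: False
          then have pos: "infdist (cay x) C > 0"
            using in_closed_iff_infdist_zero[OF that False] infdist_nonneg[of "cay x" C] by fastforce
          obtain J :: nat where J: "1 < real J * infdist (cay x) C"
            using ex_less_of_nat_mult[OF pos] by blast
          have "eventually (\<lambda>j. ?u j (cay x) = 0) sequentially"
            using eventually_ge_at_top[of J]
          proof eventually_elim
            case (elim j)
            then have "real J * infdist (cay x) C \<le> real j * infdist (cay x) C"
              using pos by (intro mult_right_mono) auto
            then show ?case using J by simp
          qed
          then show ?thesis using out by (simp add: tendsto_eventually)
        qed
        from tendsto_mult[OF tendsto_const this, of "v x * rho x"]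
        show "(\<lambda>j. v x * rho x * ?u j (cay x)) \<longlonglongrightarrow> indicat_real C (cay x) * (v x * rho x)"
          by (simp add: mult_ac)
      qed
    qed
    moreover have "(LINT x|lborel. v x * rho x * ?u j (cay x)) = 0" for j
      by (rule Ic) (intro continuous_intros)
    ultimately show ?thesis by (simp add: LIMSEQ_const_iff)
  qed simp
  have I: "(LINT x|lborel. indicat_real A (cay x) * (v x * rho x)) = 0" if "A \<in> sets borel" for A
  proof -
    have meas: "A \<in> sets borel \<Longrightarrow> cay -` A \<in> sets lborel" for A
      using measurable_sets_borel[OF cay_measurable] by simp
    have set_eq: "(LINT x|lborel. indicat_real A (cay x) * (v x * rho x)) = (LINT x:cay -` A|lborel. v x * rho x)" for A
      unfolding set_lebesgue_integral_def by (simp add: indicator_vimage)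
    have si: "set_integrable lborel B (\<lambda>x. v x * rho x)" if "B \<in> sets lborel" for B
      by (rule set_integrable_subset[OF _ that, of UNIV]) (use v in \<open>auto simp: set_integrable_def\<close>)
    have st: "Int_stable (Collect closed :: complex set set)" by (auto simp: Int_stable_def)
    have sub: "Collect closed \<subseteq> Pow (UNIV :: complex set)" by simp
    have A: "A \<in> sigma_sets UNIV (Collect closed)" using that unfolding borel_eq_closed by simp
    from st sub A have "(LINT x:cay -` A|lborel. v x * rho x) = 0"
    proof (induction rule: sigma_sets_induct_disjoint)
      case (basic A)
      then show ?case using I_le[of A] set_eq by simp
    next
      case (compl A)
      then have A: "A \<in> sets borel" unfolding borel_eq_closed by simp
      have "(LINT x:(cay -` A \<union> cay -` (UNIV - A))|lborel. v x * rho x)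
          = (LINT x:cay -` A|lborel. v x * rho x) + (LINT x:cay -` (UNIV - A)|lborel. v x * rho x)"
        by (rule set_integral_Un) (use A meas si in auto)
      moreover have "cay -` A \<union> cay -` (UNIV - A) = UNIV" by auto
      moreover have "(LINT x:UNIV|lborel. v x * rho x) = 0"
        using I_le[of UNIV] by (simp add: set_lebesgue_integral_def)
      ultimately show ?case using compl by simp
    next
      case (union A)
      then have A: "A i \<in> sets borel" for i unfolding borel_eq_closed by auto
      have "(LINT x:(\<Union>i. cay -` A i)|lborel. v x * rho x) = (\<Sum>i. LINT x:cay -` A i|lborel. v x * rho x)"
      proof (rule lebesgue_integral_countable_add)
        show "cay -` A i \<in> sets lborel" for i by (rule meas[OF A])
        show "cay -` A i \<inter> cay -` A j = {}" if "i \<noteq> j" for i j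
          using union(1) that unfolding disjoint_family_on_def by blast
        show "set_integrable lborel (\<Union>i. cay -` A i) (\<lambda>x. v x * rho x)"
          by (intro si sets.countable_UN) (use meas[OF A] in auto)
      qed
      then show ?case using union by (simp add: vimage_UN)
    qed (auto simp: set_lebesgue_integral_def)
    then show ?thesis unfolding set_eq .
  qed
  \<comment> \<open>The inverse of the Cayley transform is a Borel function, so every Borel set on the line is the preimage of one in the plane.\<close>
  have cay_inverse: "Im (cay x) / (1 + Re (cay x)) = x" for x
  proof -
    have c: "cay x = (1 + \<i> * of_real x)\<^sup>2 / of_real (1 + x\<^sup>2)"
    proof -
      have "(1 - \<i> * of_real x) * (1 + \<i> * of_real x) = of_real (1 + x\<^sup>2)"
        by (simp add: algebra_simps power2_eq_square)
      then show ?thesis unfolding cay_def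
        by (metis nonzero_mult_divide_mult_cancel_right one_plus_ii_ne(1) power2_eq_square)
    qed
    have p: "1 + x\<^sup>2 \<noteq> 0" by (simp add: add_nonneg_eq_0_iff)
    have "Re (cay x) = (1 - x\<^sup>2) / (1 + x\<^sup>2)" "Im (cay x) = 2 * x / (1 + x\<^sup>2)"
      unfolding c by (simp_all add: power2_eq_square)
    moreover have "1 + (1 - x\<^sup>2) / (1 + x\<^sup>2) = 2 / (1 + x\<^sup>2)" using p by (simp add: field_simps)
    ultimately show ?thesis using p by simp
  qed
  have S: "(LINT x|lborel. indicat_real S x * (v x * rho x)) = 0" if "S \<in> sets borel" for S
  proof -
    let ?g = "\<lambda>w. Im w / (1 + Re w)"
    have [measurable]: "?g \<in> borel_measurable borel" by measurable
    have "?g -` S \<in> sets borel" using measurable_sets_borel[OF \<open>?g \<in> _\<close> that] by simp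
    from I[OF this] show ?thesis by (simp add: indicator_def cay_inverse)
  qed
  have nonpos: "AE x in lborel. s * v x \<le> 0" if s: "s = 1 \<or> s = - 1" for s :: real
  proof -
    let ?S = "{x. s * v x > 0}"
    have [measurable]: "?S \<in> sets borel" by measurable
    let ?h = "\<lambda>x. indicat_real ?S x * (s * v x * rho x)"
    have "integrable lborel (\<lambda>x. s * v x * rho x)" using v by (simp add: mult.assoc)
    then have i: "integrable lborel ?h"
      using integrable_mult_indicator[of ?S lborel "\<lambda>x. s * v x * rho x"] by simp
    have "(LINT x|lborel. ?h x) = s * (LINT x|lborel. indicat_real ?S x * (v x * rho x))"
      unfolding integral_mult_right_zero[symmetric] by (simp add: mult_ac)
    then have "(LINT x|lborel. ?h x) = 0" using S[of ?S] by simp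
    then have "AE x in lborel. ?h x = 0"
      using integral_nonneg_eq_0_iff_AE[OF i] by (auto simp: indicator_def)
    then show ?thesis
      by eventually_elim (use rho_pos in \<open>auto simp: indicator_def not_less less_imp_neq[symmetric] split: if_splits\<close>)
  qed
  have "AE x in lborel. 1 * v x \<le> 0" "AE x in lborel. - 1 * v x \<le> 0"
    by (rule nonpos; simp)+
  then show ?thesis by eventually_elim auto
qed

section \<open>Eigenfunctions as trigonometric polynomials\<close>

text \<open>
  The difference of \<open>v\<close> and its finite Fourier sum has no coefficients left, so completeness applies.
\<close>

lemma trig_polynomial_of_circle_coeff:
  assumes v: "v \<in> borel_measurable borel" "integrable lborel (\<lambda>x. v x * rho x)"
    and high: "\<And>p. \<bar>p\<bar> > int m \<Longrightarrow> circle_coeff v p = 0"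
  shows "AE x in lborel. of_real (v x) = (\<Sum>p\<in>{- int m..int m}. circle_coeff v p * cay x powi (- p)) / of_real (2 * pi)"
proof -
  let ?I = "{- int m..int m}"
  let ?c = "circle_coeff v"
  define P where "P x = (\<Sum>p\<in>?I. ?c p * cay x powi (- p)) / of_real (2 * pi)" for x
  have cnjP: "cnj (P x) = P x" for x
  proof -
    have "(\<Sum>p\<in>?I. cnj (?c p) * cay x powi p) = (\<Sum>p\<in>?I. ?c p * cay x powi (- p))"
      by (rule sum.reindex_bij_witness[of _ uminus uminus]) (auto simp: circle_coeff_uminus)
    then show ?thesis
      unfolding P_def using cnj_cay_powi[of x "- p" for p] by (simp del: complex_cnj_power_int)
  qed
  have P_real: "of_real (Re (P x)) = P x" for x
    using arg_cong[OF cnjP, of Im] by (simp add: complex_eq_iff)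
  have P_coeff: "has_bochner_integral lborel (\<lambda>x. of_real (Re (P x) * rho x) * cay x powi n) (if \<bar>n\<bar> \<le> int m then ?c n else 0)" for n
  proof -
    have "has_bochner_integral lborel (\<lambda>x. \<Sum>p\<in>?I. ?c p / of_real (2 * pi) * (of_real (rho x) * cay x powi (n - p)))
       (\<Sum>p\<in>?I. ?c p / of_real (2 * pi) * (if n - p = 0 then of_real (2 * pi) else 0))"
      unfolding integral_rho_cay_powi[symmetric]
      by (intro has_bochner_integral_sum has_bochner_integral_mult_right
          has_bochner_integral_integrable integrable_rho_cay_powi)
    moreover have "(\<Sum>p\<in>?I. ?c p / of_real (2 * pi) * (of_real (rho x) * cay x powi (n - p)))
        = of_real (Re (P x) * rho x) * cay x powi n" for x
    proof -
      have "?c p / of_real (2 * pi) * (of_real (rho x) * cay x powi (n - p))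
          = ?c p * cay x powi (- p) * (inverse (of_real (2 * pi)) * of_real (rho x) * cay x powi n)" for p
      proof -
        have "cay x powi (n - p) = cay x powi n * cay x powi (- p)"
          by (simp add: power_int_diff power_int_minus divide_inverse)
        then show ?thesis by (simp only: divide_inverse mult_ac)
      qed
      then have "(\<Sum>p\<in>?I. ?c p / of_real (2 * pi) * (of_real (rho x) * cay x powi (n - p)))
          = (\<Sum>p\<in>?I. ?c p * cay x powi (- p) * (inverse (of_real (2 * pi)) * of_real (rho x) * cay x powi n))"
        by (simp only:)
      also have "\<dots> = (\<Sum>p\<in>?I. ?c p * cay x powi (- p)) * (inverse (of_real (2 * pi)) * of_real (rho x) * cay x powi n)"
        by (rule sum_distrib_right[symmetric])
      also have "\<dots> = P x * of_real (rho x) * cay x powi n"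
        by (simp only: P_def divide_inverse mult.assoc)
      finally show ?thesis by (simp only: of_real_mult P_real)
    qed
    moreover have "(\<Sum>p\<in>?I. ?c p / of_real (2 * pi) * (if n - p = 0 then of_real (2 * pi) else 0))
        = (\<Sum>p\<in>?I. if n = p then ?c p else 0)"
      by (rule sum.cong[OF refl]) simp
    moreover have "(\<Sum>p\<in>?I. if n = p then ?c p else 0) = (if \<bar>n\<bar> \<le> int m then ?c n else 0)"
    proof -
      have "n \<in> ?I \<longleftrightarrow> \<bar>n\<bar> \<le> int m" by auto
      then show ?thesis by (simp only: sum.delta' finite_atLeastAtMost_int)
    qed
    ultimately show ?thesis by (simp only:)
  qed
  have Pm: "(\<lambda>x. Re (P x)) \<in> borel_measurable borel" unfolding P_def by measurable
  have Pi: "integrable lborel (\<lambda>x. Re (P x) * rho x)"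
    using integrable_Re[OF integrable.intros[OF P_coeff[of 0]]] by simp
  define r where "r x = v x - Re (P x)" for x
  have "AE x in lborel. r x = 0"
  proof (rule circle_coeff_zero_imp_AE_zero)
    show "r \<in> borel_measurable borel" unfolding r_def using v Pm by measurable
    show "integrable lborel (\<lambda>x. r x * rho x)"
      unfolding r_def left_diff_distrib by (intro Bochner_Integration.integrable_diff v Pi)
    fix n
    have "circle_coeff r n = ?c n - (if \<bar>n\<bar> \<le> int m then ?c n else 0)"
      unfolding circle_coeff_def[of r] r_def
      using Bochner_Integration.integral_diff[OF integrable_weighted_cay_powi[OF v(2), of n] integrable.intros[OF P_coeff[of n]]]
        has_bochner_integral_integral_eq[OF P_coeff[of n]]
      by (simp add: left_diff_distrib circle_coeff_def)
    then show "circle_coeff r n = 0" using high[of n] by auto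
  qed
  then show ?thesis
  proof eventually_elim
    case (elim x)
    then have "v x = Re (P x)" by (simp add: r_def)
    then show ?case using P_real[of x] unfolding P_def by simp
  qed
qed

text \<open>
  Multiplication by \<open>rho = (2 + \<zeta> + 1/\<zeta>) / 2\<close> shifts indices by at most one, and nothing leaves the
  range because \<open>d\<close> vanishes at its ends.
\<close>

lemma trig_polynomial_shift:
  fixes c d :: "int \<Rightarrow> complex"
  assumes rec: "\<And>p. 2 * of_real E * c p = d (p + 1) + 2 * d p + d (p - 1)"
    and d0: "\<And>p. \<bar>p\<bar> \<ge> int m \<Longrightarrow> d p = 0"
  shows "of_real E * (\<Sum>p\<in>{- int m..int m}. c p * cay x powi (- p))
       = of_real (rho x) * (\<Sum>p\<in>{- int m..int m}. d p * cay x powi (- p))"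
proof -
  let ?I = "{- int m..int m}" and ?z = "cay x"
  define S where "S = (\<Sum>p\<in>?I. d p * ?z powi (- p))"
  have up: "(\<Sum>p\<in>?I. d (p + 1) * ?z powi (- p)) = ?z * S"
  proof -
    have "(\<Sum>p\<in>?I. d (p + 1) * ?z powi (- p)) = (\<Sum>p\<in>{- int m + 1..int m + 1}. d p * ?z powi (1 - p))"
      by (rule sum.reindex_bij_witness[of _ "\<lambda>p. p - 1" "\<lambda>p. p + 1"]) auto
    also have "\<dots> = (\<Sum>p\<in>{- int m..int m + 1}. d p * ?z powi (1 - p))"
      by (rule sum.mono_neutral_left) (auto simp: d0)
    also have "\<dots> = (\<Sum>p\<in>?I. d p * ?z powi (1 - p))"
      by (rule sum.mono_neutral_right) (auto simp: d0)
    finally show ?thesis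
      by (simp add: S_def sum_distrib_left power_int_diff power_int_minus divide_inverse mult_ac)
  qed
  have down: "(\<Sum>p\<in>?I. d (p - 1) * ?z powi (- p)) = inverse ?z * S"
  proof -
    have "(\<Sum>p\<in>?I. d (p - 1) * ?z powi (- p)) = (\<Sum>p\<in>{- int m - 1..int m - 1}. d p * ?z powi (- p - 1))"
      by (rule sum.reindex_bij_witness[of _ "\<lambda>p. p + 1" "\<lambda>p. p - 1"]) auto
    also have "\<dots> = (\<Sum>p\<in>{- int m - 1..int m}. d p * ?z powi (- p - 1))"
      by (rule sum.mono_neutral_left) (auto simp: d0)
    also have "\<dots> = (\<Sum>p\<in>?I. d p * ?z powi (- p - 1))"
      by (rule sum.mono_neutral_right) (auto simp: d0)
    finally show ?thesis
      by (simp add: S_def sum_distrib_left power_int_diff power_int_minus divide_inverse mult_ac)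
  qed
  have "2 * (of_real E * (\<Sum>p\<in>?I. c p * ?z powi (- p))) = (\<Sum>p\<in>?I. 2 * of_real E * c p * ?z powi (- p))"
    by (simp add: sum_distrib_left mult.assoc)
  also have "\<dots> = ?z * S + 2 * S + inverse ?z * S"
    unfolding rec distrib_right sum.distrib up down
    by (simp add: S_def sum_distrib_left mult.assoc)
  also have "\<dots> = 2 * (of_real (rho x) * S)"
    unfolding rho_eq_cay by (simp add: algebra_simps)
  finally show ?thesis unfolding S_def by simp
qed

text \<open>
  Multiplied by \<open>E\<close>, the eigenfunction is \<open>rho\<close> times a trigonometric polynomial of degree below \<open>m\<close>,
  because the factor \<open>|p| - m\<close> removes the extreme modes. Pairing it with \<open>f\<close> on the line therefore
  sees only finitely many circle coefficients of \<open>f\<close>.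
\<close>

lemma eigen_pairing:
  assumes ef: "Lplus m (\<lambda>x. of_real (v x)) (\<lambda>x. of_real E * of_real (v x))" and E: "E \<le> 0"
    and f: "f \<in> borel_measurable borel" "integrable lborel (\<lambda>x. f x * rho x)"
  shows "of_real (2 * pi * E * (LINT x|lborel. v x * f x))
     = (\<Sum>p\<in>{- int m..int m}. of_int (\<bar>p\<bar> - int m) * circle_coeff v p * circle_coeff f (- p))"
proof -
  let ?I = "{- int m..int m}"
  let ?d = "\<lambda>p. of_int (\<bar>p\<bar> - int m) * circle_coeff v p"
  note vr = integrable_L2_rho[OF eigen_L2[OF ef]]
  have d0: "?d p = 0" if "\<bar>p\<bar> \<ge> int m" for p
    using eigen_coeff_vanish[OF ef E, of p] that by (cases "\<bar>p\<bar> = int m") auto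
  have b: "has_bochner_integral lborel (\<lambda>x. \<Sum>p\<in>?I. ?d p * (of_real (f x * rho x) * cay x powi (- p)))
     (\<Sum>p\<in>?I. ?d p * circle_coeff f (- p))"
    unfolding circle_coeff_def[of f]
    by (intro has_bochner_integral_sum has_bochner_integral_mult_right
          has_bochner_integral_integrable integrable_weighted_cay_powi f)
  have rep: "AE x in lborel. of_real (v x) = (\<Sum>p\<in>?I. circle_coeff v p * cay x powi (- p)) / of_real (2 * pi)"
    by (rule trig_polynomial_of_circle_coeff[OF vr(1,4)]) (rule eigen_coeff_vanish[OF ef E])
  have ae: "AE x in lborel. of_real (2 * pi * E * (v x * f x)) = (\<Sum>p\<in>?I. ?d p * (of_real (f x * rho x) * cay x powi (- p)))"
    using rep
  proof eventually_elim
    case (elim x)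
    have "complex_of_real (2 * pi * E * (v x * f x)) = of_real (2 * pi) * of_real (f x) * (of_real E * of_real (v x))"
      by simp
    also have "\<dots> = of_real (f x) * (of_real E * (\<Sum>p\<in>?I. circle_coeff v p * cay x powi (- p)))"
      unfolding elim by simp
    also have "\<dots> = of_real (f x) * (of_real (rho x) * (\<Sum>p\<in>?I. ?d p * cay x powi (- p)))"
      using trig_polynomial_shift[OF eigen_recurrence[OF ef], of m x] d0 by simp
    finally show ?case by (simp add: sum_distrib_left mult_ac)
  qed
  have "complex_of_real (2 * pi * E * (LINT x|lborel. v x * f x)) = (LINT x|lborel. complex_of_real (2 * pi * E * (v x * f x)))"
    by (simp only: integral_complex_of_real integral_mult_right_zero)
  also have "\<dots> = (LINT x|lborel. (\<Sum>p\<in>?I. ?d p * (of_real (f x * rho x) * cay x powi (- p))))"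
    by (rule integral_cong_AE) (use ae vr f in measurable)
  also have "\<dots> = (\<Sum>p\<in>?I. ?d p * circle_coeff f (- p))"
    by (rule has_bochner_integral_integral_eq[OF b])
  finally show ?thesis .
qed

text \<open>
  The right-hand side of \<open>eigen_pairing\<close> is symmetric in the two functions under \<open>p \<mapsto> - p\<close>.
\<close>

lemma eigen_orthogonal:
  assumes v: "Lplus m (\<lambda>x. of_real (v x)) (\<lambda>x. of_real E * of_real (v x))" "E \<le> 0"
    and w: "Lplus m (\<lambda>x. of_real (w x)) (\<lambda>x. of_real F * of_real (w x))" "F \<le> 0"
    and EF: "E \<noteq> F"
  shows "(LINT x|lborel. v x * w x) = 0"
proof -
  note vr = integrable_L2_rho[OF eigen_L2[OF v(1)]] and wr = integrable_L2_rho[OF eigen_L2[OF w(1)]]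
  have "complex_of_real (2 * pi * E * (LINT x|lborel. v x * w x)) = of_real (2 * pi * F * (LINT x|lborel. w x * v x))"
    unfolding eigen_pairing[OF v wr(1,4)] eigen_pairing[OF w vr(1,4)]
    by (rule sum.reindex_bij_witness[of _ uminus uminus]) auto
  then have "E * (LINT x|lborel. v x * w x) = F * (LINT x|lborel. v x * w x)"
    by (simp only: of_real_eq_iff) (simp add: mult.commute[of "w _"])
  then show ?thesis using EF by simp
qed

text \<open>
  For \<open>E = 0\<close> the recurrence runs backwards from two zeros of \<open>d\<close>, so only the modes \<open>\<plusminus> m\<close> survive.
  Of these, the real part of \<open>\<zeta>\<^sup>m\<close> tends to \<open>\<plusminus> 1\<close> at infinity and is excluded by
  square integrability.
\<close>

lemma zero_mode:
  assumes ef: "Lplus m (\<lambda>x. of_real (v x)) (\<lambda>x. of_real 0 * of_real (v x))"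
  obtains b where "AE x in lborel. v x = b * Im (cay x ^ m)"
proof -
  let ?c = "circle_coeff v"
  define d where "d p = of_int (\<bar>p\<bar> - int m) * ?c p" for p
  note L2 = eigen_L2[OF ef]
  note vr = integrable_L2_rho[OF L2]
  have rec: "d (p - 1) = - d (p + 1) - 2 * d p" for p
  proof -
    have "0 = d (p + 1) + 2 * d p + d (p - 1)"
      using eigen_recurrence[OF ef, of p] unfolding d_def by simp
    then show ?thesis by (simp add: algebra_simps eq_neg_iff_add_eq_0)
  qed
  have high: "?c p = 0" if "\<bar>p\<bar> > int m" for p using eigen_coeff_vanish[OF ef order_refl that] .
  have "d (int m - int k) = 0 \<and> d (int m - int k + 1) = 0" for k
  proof (induction k)
    case 0
    then show ?case using high[of "int m + 1"] by (simp add: d_def)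
  next
    case (Suc k)
    have e: "int m - int (Suc k) = (int m - int k) - 1" by simp
    show ?case unfolding e rec using Suc by simp
  qed
  note d = this
  have c0: "?c p = 0" if "\<bar>p\<bar> \<noteq> int m" for p
  proof (cases "\<bar>p\<bar> > int m")
    case False
    then have "int m - int (nat (int m - p)) = p" by simp
    then have "d p = 0" using d[of "nat (int m - p)"] by metis
    then show ?thesis using that by (simp add: d_def flip: of_int_diff)
  qed (rule high)
  have z: "?c p = 0" if "p \<noteq> int m" "p \<noteq> - int m" for p
    by (rule c0) (use that in linarith)
  define g where "g = ?c (- int m) / of_real pi"
  have rep0: "AE x in lborel. of_real (v x) = (\<Sum>p\<in>{- int m..int m}. ?c p * cay x powi (- p)) / of_real (2 * pi)"
    by (rule trig_polynomial_of_circle_coeff[OF vr(1,4)]) (rule high)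
  have rep: "AE x in lborel. v x = (if m = 0 then Re g / 2 else Re (g * cay x ^ m))"
    using rep0
  proof eventually_elim
    case (elim x)
    have "(\<Sum>p\<in>{- int m..int m}. ?c p * cay x powi (- p)) = (\<Sum>p\<in>{- int m, int m}. ?c p * cay x powi (- p))"
      by (rule sum.mono_neutral_right) (auto simp: z)
    also have "\<dots> = of_real (2 * pi * (if m = 0 then Re g / 2 else Re (g * cay x ^ m)))"
    proof (cases "m = 0")
      case True
      have "cnj (?c 0) = ?c 0" using circle_coeff_uminus[of v 0] by simp
      from arg_cong[OF this, of Im] have "?c 0 = of_real (Re (?c 0))" by (simp add: complex_eq_iff)
      then show ?thesis using True by (simp add: g_def)
    next
      case False
      have "?c (- int m) * cay x ^ m + cnj (?c (- int m) * cay x ^ m) = of_real (2 * pi * Re (g * cay x ^ m))"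
        unfolding complex_add_cnj g_def by simp
      moreover have "cnj (cay x ^ m) = cay x powi (- int m)" using cnj_cay_powi[of x "int m"] by simp
      ultimately show ?thesis using False circle_coeff_uminus[of v "- int m"] by simp
    qed
    finally have "of_real (v x) = complex_of_real (if m = 0 then Re g / 2 else Re (g * cay x ^ m))"
      unfolding elim by simp
    then show ?case by (simp only: of_real_eq_iff)
  qed
  \<comment> \<open>The value of the surviving part at infinity. A nonzero constant is not square integrable on the line.\<close>
  define a where "a = (if m = 0 then Re g / 2 else Re g * (- 1) ^ m)"
  have a0: "a = 0"
  proof -
    have i: "integrable lborel (\<lambda>x. 2 * (v x)\<^sup>2 + 2 * (norm g * real m)\<^sup>2 * (2 * rho x))"
      using vr(2) integrable_rho by simp
    have "integrable lborel (\<lambda>x::real. a\<^sup>2)"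
    proof (rule Bochner_Integration.integrable_bound[OF i])
      show "AE x in lborel. norm (a\<^sup>2) \<le> norm (2 * (v x)\<^sup>2 + 2 * (norm g * real m)\<^sup>2 * (2 * rho x))"
        using rep
      proof eventually_elim
        case (elim x)
        have n1: "(norm (1 + cay x))\<^sup>2 = 2 * rho x"
          unfolding one_plus_cay by (simp add: norm_divide power_divide cmod_power2 rho_def)
        have "\<bar>a - v x\<bar> \<le> norm g * real m * norm (1 + cay x)"
        proof (cases "m = 0")
          case False
          have "a - v x = Re (g * ((- 1) ^ m - cay x ^ m))"
            unfolding elim a_def using False by (simp add: right_diff_distrib minus_one_power_iff)
          then have "\<bar>a - v x\<bar> \<le> norm g * norm ((- 1) ^ m - cay x ^ m)"
            using abs_Re_le_cmod by (metis norm_mult)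
          also have "norm ((- 1) ^ m - cay x ^ m) \<le> real m * norm (- 1 - cay x)"
            by (rule norm_power_diff) auto
          also have "norm (- 1 - cay x) = norm (1 + cay x)"
            using norm_minus_cancel[of "1 + cay x"] by simp
          finally show ?thesis by (simp add: mult_left_mono mult.assoc)
        qed (simp add: elim a_def)
        then have "(a - v x)\<^sup>2 \<le> (norm g * real m * norm (1 + cay x))\<^sup>2"
          by (subst power2_abs[symmetric]) (intro power_mono, auto)
        then have "(a - v x)\<^sup>2 \<le> (norm g * real m)\<^sup>2 * (2 * rho x)"
          by (simp only: power_mult_distrib n1)
        moreover have "a\<^sup>2 \<le> 2 * (v x)\<^sup>2 + 2 * (a - v x)\<^sup>2"
          using zero_le_power2[of "a - 2 * v x"] by (simp add: power2_eq_square algebra_simps)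
        ultimately have "a\<^sup>2 \<le> 2 * (v x)\<^sup>2 + 2 * (norm g * real m)\<^sup>2 * (2 * rho x)"
          by linarith
        then show ?case by simp
      qed
    qed simp
    then have "(\<integral>\<^sup>+ y. ennreal (a\<^sup>2) \<partial>(lborel :: real measure)) < \<infinity>"
      by (simp add: integrable_iff_bounded)
    then show ?thesis
      by (cases "a = 0") (simp_all add: ennreal_mult_top)
  qed
  have "AE x in lborel. v x = - Im g * Im (cay x ^ m)"
    using rep by eventually_elim (use a0 in \<open>auto simp: a_def split: if_splits\<close>)
  then show ?thesis by (rule that)
qed

section \<open>The orthogonality conditions and the quadratic forms\<close>

text \<open>
  The rows of a square matrix with independent rows separate points: a matrix and its transpose are
  singular together.
\<close>

lemma dual_family_separates:
  fixes a :: "nat \<Rightarrow> nat \<Rightarrow> 'a :: field"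
  assumes indep: "\<And>x. (\<And>j. j < n \<Longrightarrow> (\<Sum>k<n. x k * a k j) = 0) \<Longrightarrow> (\<And>k. k < n \<Longrightarrow> x k = 0)"
    and y: "\<And>k. k < n \<Longrightarrow> (\<Sum>j<n. a k j * y j) = 0" and j: "j < n"
  shows "y j = 0"
proof (rule ccontr)
  assume nz: "y j \<noteq> 0"
  define A where "A = mat n n (\<lambda>(k, j). a k j)"
  have A: "A \<in> carrier_mat n n" by (simp add: A_def)
  have "A *\<^sub>v vec n y = 0\<^sub>v n"
    by (rule eq_vecI) (auto simp: A_def scalar_prod_def y lessThan_atLeast0[symmetric])
  moreover have "vec n y \<noteq> 0\<^sub>v n" using nz j by (metis index_vec index_zero_vec(1))
  ultimately have "det A = 0"
    using det_0_iff_vec_prod_zero_field[OF A] vec_carrier by blast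
  then have "det (transpose_mat A) = 0" using det_transpose[OF A] by simp
  then obtain x where x: "x \<in> carrier_vec n" "x \<noteq> 0\<^sub>v n" "transpose_mat A *\<^sub>v x = 0\<^sub>v n"
    using det_0_iff_vec_prod_zero_field[of "transpose_mat A" n] A by auto
  have "(\<Sum>k<n. x $ k * a k j) = 0" if "j < n" for j
  proof -
    have "(transpose_mat A *\<^sub>v x) $ j = (\<Sum>k<n. x $ k * a k j)"
      using that x(1) by (simp add: A_def scalar_prod_def lessThan_atLeast0 mult.commute)
    then show ?thesis using x(3) that by simp
  qed
  then have "x $ k = 0" if "k < n" for k using indep[of "\<lambda>k. x $ k"] that by blast
  then have "x = 0\<^sub>v n" using x(1) by (intro eq_vecI) auto
  then show False using x(2) by simp
qed

lemma moebius_eq: "\<i> * ((of_real x - \<i>) / (of_real x + \<i>)) = - \<i> * cay x"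
proof -
  have "of_real x - \<i> = - \<i> * (1 + \<i> * of_real x)" "of_real x + \<i> = \<i> * (1 - \<i> * of_real x)"
    by (simp_all add: algebra_simps)
  then show ?thesis by (simp add: cay_def)
qed

text \<open>
  The first two components of \<open>Q_map\<close> are the real and imaginary parts of \<open>(- i \<zeta>)\<^sup>m\<close>.
\<close>

lemma norm_Q_map_diff_sq:
  "(norm (Q_map m x - Q_map m y))\<^sup>2 = rho x * rho y * (x - y)\<^sup>2 * fejer m x y"
proof -
  have "(norm (Q_map m x - Q_map m y))\<^sup>2 = (f_fun m x - f_fun m y)\<^sup>2 + (g_fun m x - g_fun m y)\<^sup>2"
    by (simp add: norm_vec_def L2_set_def sum_3 Q_map_def real_sqrt_pow2)
  also have "\<dots> = (norm ((- \<i> * cay x) ^ m - (- \<i> * cay y) ^ m))\<^sup>2"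
    unfolding f_fun_def g_fun_def moebius_eq cmod_power2 by simp
  also have "(- \<i> * cay x) ^ m - (- \<i> * cay y) ^ m = (- \<i>) ^ m * (cay x ^ m - cay y ^ m)"
    by (simp only: power_mult_distrib right_diff_distrib)
  finally show ?thesis by (simp add: norm_mult norm_power norm_cay_power_diff_sq)
qed

text \<open>
  Up to a constant, the kernel of \<open>R\<close> is \<open>rho x rho y\<close> times a trigonometric polynomial of degree below \<open>m\<close>.
\<close>

lemma R_op_eq_0:
  assumes f: "f \<in> borel_measurable borel" "integrable lborel (\<lambda>x. f x * rho x)"
    and c0: "\<And>p. \<bar>p\<bar> < int m \<Longrightarrow> circle_coeff f p = 0"
  shows "R_op m f x = 0"
proof -
  note [measurable] = f(1)
  let ?k = "\<lambda>y. (norm (Q_map m x - Q_map m y))\<^sup>2 / \<bar>x - y\<bar>\<^sup>2 * f y"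
  have "has_bochner_integral lborel
     (\<lambda>y. \<Sum>j<m. \<Sum>l<m. of_real (rho x) * cay x powi (int j - int l) * (of_real (f y * rho y) * cay y powi (- (int j - int l))))
     (\<Sum>j<m. \<Sum>l<m. of_real (rho x) * cay x powi (int j - int l) * circle_coeff f (- (int j - int l)))"
    unfolding circle_coeff_def
    by (intro has_bochner_integral_sum has_bochner_integral_mult_right
          has_bochner_integral_integrable integrable_weighted_cay_powi f)
  moreover have "(\<Sum>j<m. \<Sum>l<m. of_real (rho x) * cay x powi (int j - int l) * circle_coeff f (- (int j - int l))) = 0"
    by (intro sum.neutral ballI) (simp add: c0)
  moreover have "(\<Sum>j<m. \<Sum>l<m. of_real (rho x) * cay x powi (int j - int l) * (of_real (f y * rho y) * cay y powi (- (int j - int l))))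
      = of_real (rho x * rho y * fejer m x y * f y)" for y
    unfolding of_real_mult fejer_eq_sum sum_distrib_left sum_distrib_right
    by (intro sum.cong refl) (simp only: mult_ac)
  ultimately have "has_bochner_integral lborel (\<lambda>y. complex_of_real (rho x * rho y * fejer m x y * f y)) 0"
    by (simp only:)
  from has_bochner_integral_Re[OF this]
  have i: "has_bochner_integral lborel (\<lambda>y. rho x * rho y * fejer m x y * f y) 0" by simp
  have "(LINT y|lborel. ?k y) = (LINT y|lborel. rho x * rho y * fejer m x y * f y)"
  proof (rule integral_cong_AE)
    have e: "?k y = (if y = x then 0 else rho x * rho y * fejer m x y * f y)" for y
      unfolding norm_Q_map_diff_sq by simp
    have im: "(\<lambda>y. rho x * rho y * fejer m x y * f y) \<in> borel_measurable lborel"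
      using i by (auto simp: has_bochner_integral_iff)
    then show "?k \<in> borel_measurable lborel" unfolding e by measurable
    show "AE y in lborel. ?k y = rho x * rho y * fejer m x y * f y"
      using AE_lborel_singleton[of x] unfolding e by eventually_elim simp
  qed (use i in \<open>auto simp: has_bochner_integral_iff\<close>)
  then show ?thesis using has_bochner_integral_integral_eq[OF i] by (simp add: R_op_def)
qed

lemma Hdot_half_weighted_integrable:
  assumes "f \<in> Hdot_half"
  shows "integrable lborel (\<lambda>x. f x * rho x)"
proof -
  have [measurable]: "f \<in> borel_measurable borel" using assms by (simp add: Hdot_half_def)
  have "integrable lborel (\<lambda>x. 2 * (\<bar>f x\<bar> / (1 + x\<^sup>2)))"
    by (rule integrable_mult_right) (use assms in \<open>simp add: Hdot_half_def\<close>)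
  then show ?thesis
    by (rule Bochner_Integration.integrable_bound) (auto simp: rho_def abs_mult mult.commute)
qed

text \<open>
  For almost every \<open>a\<close> the function \<open>(f a - f y)\<^sup>2 / (a - y)\<^sup>2\<close> of \<open>y\<close> is integrable, and
  \<open>1 / (a - y)\<^sup>2\<close> dominates a multiple of \<open>rho y\<close>.
\<close>

lemma Hdot_half_weighted_square_integrable:
  assumes f: "f \<in> Hdot_half"
  shows "integrable lborel (\<lambda>x. (f x)\<^sup>2 * rho x)"
proof -
  have [measurable]: "f \<in> borel_measurable borel" using f by (simp add: Hdot_half_def)
  have G: "integrable (lborel \<Otimes>\<^sub>M lborel) (\<lambda>(x, y). \<bar>f x - f y\<bar>\<^sup>2 / \<bar>x - y\<bar>\<^sup>2)"
    using f by (simp add: Hdot_half_def)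
  have "ae_filter (lborel :: real measure) \<noteq> bot" by (simp add: ae_filter_eq_bot_iff)
  from eventually_happens'[OF this lborel_pair.AE_integrable_fst'[OF G]]
  obtain a where a: "integrable lborel (\<lambda>y. \<bar>f a - f y\<bar>\<^sup>2 / \<bar>a - y\<bar>\<^sup>2)" by auto
  show ?thesis
  proof (rule Bochner_Integration.integrable_bound)
    show "integrable lborel (\<lambda>y. 2 * (f a)\<^sup>2 * rho y + 2 * (4 * (1 + a\<^sup>2) * (\<bar>f a - f y\<bar>\<^sup>2 / \<bar>a - y\<bar>\<^sup>2)))"
      by (intro Bochner_Integration.integrable_add integrable_mult_right integrable_rho a)
    show "AE y in lborel. norm ((f y)\<^sup>2 * rho y)
       \<le> norm (2 * (f a)\<^sup>2 * rho y + 2 * (4 * (1 + a\<^sup>2) * (\<bar>f a - f y\<bar>\<^sup>2 / \<bar>a - y\<bar>\<^sup>2)))"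
    proof (intro AE_I2)
      fix y
      have d: "(f a - f y)\<^sup>2 * rho y \<le> 4 * (1 + a\<^sup>2) * (\<bar>f a - f y\<bar>\<^sup>2 / \<bar>a - y\<bar>\<^sup>2)"
      proof (cases "a = y")
        case False
        have "(a - y)\<^sup>2 \<le> 2 * a\<^sup>2 + 2 * y\<^sup>2"
          using zero_le_power2[of "a + y"] by (simp add: power2_eq_square algebra_simps)
        also have "\<dots> \<le> 2 * (1 + a\<^sup>2) * (1 + y\<^sup>2)"
          using mult_nonneg_nonneg[of "a\<^sup>2" "y\<^sup>2"] by (simp add: algebra_simps)
        finally have "(a - y)\<^sup>2 / (1 + y\<^sup>2) \<le> 2 * (1 + a\<^sup>2)"
          by (simp add: pos_divide_le_eq add_pos_nonneg)
        moreover have "rho y * (a - y)\<^sup>2 = 2 * ((a - y)\<^sup>2 / (1 + y\<^sup>2))" by (simp add: rho_def)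
        ultimately have "rho y * (a - y)\<^sup>2 \<le> 4 * (1 + a\<^sup>2)" by linarith
        then have "rho y \<le> 4 * (1 + a\<^sup>2) / (a - y)\<^sup>2" using False by (simp add: pos_le_divide_eq)
        then have "(f a - f y)\<^sup>2 * rho y \<le> (f a - f y)\<^sup>2 * (4 * (1 + a\<^sup>2) / (a - y)\<^sup>2)"
          by (intro mult_left_mono) auto
        then show ?thesis by (simp add: mult_ac)
      qed simp
      have "(f y)\<^sup>2 * rho y \<le> (2 * (f a)\<^sup>2 + 2 * (f a - f y)\<^sup>2) * rho y"
        using zero_le_power2[of "2 * f a - f y"]
        by (intro mult_right_mono) (simp_all add: power2_eq_square algebra_simps)
      also have "\<dots> = 2 * (f a)\<^sup>2 * rho y + 2 * ((f a - f y)\<^sup>2 * rho y)"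
        by (simp only: distrib_right mult.assoc)
      also have "\<dots> \<le> 2 * (f a)\<^sup>2 * rho y + 2 * (4 * (1 + a\<^sup>2) * (\<bar>f a - f y\<bar>\<^sup>2 / \<bar>a - y\<bar>\<^sup>2))"
        using d by simp
      finally have "(f y)\<^sup>2 * rho y \<le> 2 * (f a)\<^sup>2 * rho y + 2 * (4 * (1 + a\<^sup>2) * (\<bar>f a - f y\<bar>\<^sup>2 / \<bar>a - y\<bar>\<^sup>2))" .
      then show "norm ((f y)\<^sup>2 * rho y)
         \<le> norm (2 * (f a)\<^sup>2 * rho y + 2 * (4 * (1 + a\<^sup>2) * (\<bar>f a - f y\<bar>\<^sup>2 / \<bar>a - y\<bar>\<^sup>2)))"
        by (simp add: abs_of_nonneg)
    qed
  qed measurable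
qed

text \<open>
  The potential term is \<open>m\<close> times the weighted square integral, which is at most \<open>m / (m + 1)\<close> of the
  energy.
\<close>

lemma Lplus_form_ge:
  assumes f: "f \<in> Hdot_half" and low: "\<And>n. \<bar>n\<bar> \<le> int m \<Longrightarrow> circle_coeff f n = 0"
  shows "1 / (real m + 1) * Hdot_half_norm_sq f \<le> Lplus_form m f"
proof -
  let ?I = "LINT x|lborel. (f x)\<^sup>2 * rho x"
  have "(LINT x|lborel. 2 * real m / (1 + x\<^sup>2) * \<bar>f x\<bar>\<^sup>2) = (LINT x|lborel. real m * ((f x)\<^sup>2 * rho x))"
    by (simp add: rho_def mult_ac)
  then have "Lplus_form m f = Hdot_half_norm_sq f - real m * ?I"
    unfolding Lplus_form_def by simp
  moreover have "(real m + 1) * ?I \<le> Hdot_half_norm_sq f"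
    by (rule Hdot_half_norm_sq_ge[OF f Hdot_half_weighted_square_integrable[OF f] low])
  then have "real m * ((real m + 1) * ?I) \<le> real m * Hdot_half_norm_sq f"
    by (rule mult_left_mono) simp
  then have "real m * ?I \<le> real m / (real m + 1) * Hdot_half_norm_sq f"
    by (simp add: field_simps)
  moreover have "1 / (real m + 1) + real m / (real m + 1) = 1"
    by (simp add: field_simps)
  then have "1 / (real m + 1) * Hdot_half_norm_sq f + real m / (real m + 1) * Hdot_half_norm_sq f = Hdot_half_norm_sq f"
    by (metis distrib_right mult_1)
  ultimately show ?thesis by linarith
qed

lemma divide_eq_rho_half: "v / (1 + x\<^sup>2) = v * (rho x / 2)"
proof -
  have "v / y = v * ((2 / y) / 2)" for y :: real by simp
  then show ?thesis unfolding rho_def .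
qed

text \<open>
  The \<open>2 m + 1\<close> orthogonality conditions force the vanishing of the coefficients
  with index between \<open>- m\<close> and \<open>m\<close>. Negative eigenvalues account for the inner ones: by \<open>eigen_pairing\<close> each condition is a linear equation between them, and the \<open>2 m - 1\<close>
  equations are independent because the eigenfunctions are orthonormal. The zero mode and the
  resonance, both divided by \<open>1 + x\<^sup>2\<close>, account for the imaginary and real parts of the
  coefficient of index \<open>m\<close>.
\<close>

lemma low_circle_coeff_zero:
  fixes m :: nat and E :: "nat \<Rightarrow> real" and \<phi> :: "nat \<Rightarrow> real \<Rightarrow> real" and f :: "real \<Rightarrow> real"
  assumes m: "m \<ge> 1" and mono: "strict_mono_on {..<2 * m} E" and E0: "E (2 * m - 1) = 0"
    and ef: "\<And>k. k < 2 * m \<Longrightarrow> Lplus m (\<lambda>x. of_real (\<phi> k x)) (\<lambda>x. of_real (E k) * of_real (\<phi> k x))"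
    and norm1: "\<And>k. k < 2 * m \<Longrightarrow> (LINT x|lborel. (\<phi> k x)\<^sup>2) = 1"
    and f: "f \<in> borel_measurable borel" "integrable lborel (\<lambda>x. f x * rho x)"
    and orth: "\<And>k. k \<le> 2 * m \<Longrightarrow> (LINT x|lborel. psi m \<phi> k x * f x) = 0"
    and p: "\<bar>p\<bar> \<le> int m"
  shows "circle_coeff f p = 0"
proof -
  have Eneg: "E k < 0" if "k < 2 * m - 1" for k
    using strict_mono_onD[OF mono, of k "2 * m - 1"] that E0 by simp
  have Ele: "E k \<le> 0" if "k < 2 * m" for k
    using Eneg[of k] E0 that by (cases "k = 2 * m - 1") (auto simp: less_imp_le)
  have Einj: "E k \<noteq> E l" if "k < 2 * m" "l < 2 * m" "k \<noteq> l" for k l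
    using strict_mono_on_imp_inj_on[OF mono] that by (auto simp: inj_on_def)
  let ?I = "{- int m..int m}"
  define n where "n = 2 * m - 1"
  \<comment> \<open>The indices \<open>0, ..., n - 1\<close> enumerate the modes \<open>1 - m, ..., m - 1\<close>.\<close>
  define idx where "idx j = int j - (int m - 1)" for j
  define d where "d k p = of_int (\<bar>p\<bar> - int m) * circle_coeff (\<phi> k) p" for k p
  have reindex: "(\<Sum>p\<in>?I. d k p * h p) = (\<Sum>j<n. d k (idx j) * h (idx j))" for k h
  proof -
    have "(\<Sum>p\<in>?I. d k p * h p) = (\<Sum>p\<in>{- int m + 1..int m - 1}. d k p * h p)"
    proof (rule sum.mono_neutral_right)
      show "\<forall>p\<in>?I - {- int m + 1..int m - 1}. d k p * h p = 0"
      proof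
        fix p assume "p \<in> ?I - {- int m + 1..int m - 1}"
        then have "\<bar>p\<bar> = int m" by auto
        then show "d k p * h p = 0" by (simp add: d_def)
      qed
    qed auto
    also have "\<dots> = (\<Sum>j<n. d k (idx j) * h (idx j))"
      by (rule sum.reindex_bij_witness[of _ idx "\<lambda>p. nat (p + (int m - 1))"])
         (use m in \<open>auto simp: idx_def n_def\<close>)
    finally show ?thesis .
  qed
  have inner: "circle_coeff f p = 0" if "\<bar>p\<bar> < int m" for p
  proof -
    have "circle_coeff f (- idx j) = 0" if "j < n" for j
    proof (rule dual_family_separates[OF _ _ that, where a = "\<lambda>k j. d k (idx j)"])
      fix k assume k: "k < n"
      then have "k \<le> 2 * m - 2" "k \<le> 2 * m" using m by (auto simp: n_def)
      then have "(LINT x|lborel. \<phi> k x * f x) = 0"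
        using orth[of k] by (simp add: psi_def)
      then show "(\<Sum>j<n. d k (idx j) * circle_coeff f (- idx j)) = 0"
        using eigen_pairing[OF ef Ele f, of k] k reindex[of k "\<lambda>p. circle_coeff f (- p)"]
        by (simp add: n_def d_def)
    next
      fix x :: "nat \<Rightarrow> complex" and l
      assume x: "\<And>j. j < n \<Longrightarrow> (\<Sum>k<n. x k * d k (idx j)) = 0" and l: "l < n"
      then have l2: "l < 2 * m" by (simp add: n_def)
      note vr = integrable_L2_rho[OF eigen_L2[OF ef[OF l2]]]
      have pair: "(\<Sum>j<n. d k (idx j) * circle_coeff (\<phi> l) (- idx j))
          = (if k = l then of_real (2 * pi * E l) else 0)" if k: "k < n" for k
      proof -
        have k2: "k < 2 * m" using k by (simp add: n_def)
        have "(\<Sum>j<n. d k (idx j) * circle_coeff (\<phi> l) (- idx j))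
            = of_real (2 * pi * E k * (LINT x|lborel. \<phi> k x * \<phi> l x))"
          using reindex[of k "\<lambda>p. circle_coeff (\<phi> l) (- p)"]
          unfolding eigen_pairing[OF ef[OF k2] Ele[OF k2] vr(1,4)] d_def by simp
        moreover have "(LINT x|lborel. \<phi> l x * \<phi> l x) = 1"
          using norm1[OF l2] by (simp add: power2_eq_square)
        moreover have "k \<noteq> l \<Longrightarrow> (LINT x|lborel. \<phi> k x * \<phi> l x) = 0"
          using eigen_orthogonal[OF ef[OF k2] Ele[OF k2] ef[OF l2] Ele[OF l2] Einj[OF k2 l2]] .
        ultimately show ?thesis by auto
      qed
      have "0 = (\<Sum>j<n. (\<Sum>k<n. x k * d k (idx j)) * circle_coeff (\<phi> l) (- idx j))"
        using x by simp
      also have "\<dots> = (\<Sum>k<n. x k * (\<Sum>j<n. d k (idx j) * circle_coeff (\<phi> l) (- idx j)))"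
        unfolding sum_distrib_left sum_distrib_right
        by (subst sum.swap) (simp only: mult.assoc)
      also have "\<dots> = (\<Sum>k<n. if k = l then x l * of_real (2 * pi * E l) else 0)"
        by (intro sum.cong) (auto simp: pair)
      also have "\<dots> = x l * of_real (2 * pi * E l)" using l by simp
      finally show "x l = 0" using Eneg[of l] l by (simp add: n_def)
    qed
    note zero = this
    have "- idx (nat (int m - 1 - p)) = p" "nat (int m - 1 - p) < n"
      using that m unfolding idx_def n_def by auto
    then show ?thesis using zero by metis
  qed
  have outer: "circle_coeff f (int m) = 0"
  proof -
    have C: "has_bochner_integral lborel (\<lambda>x. of_real (f x * rho x) * cay x ^ m) (circle_coeff f (int m))"
      using has_bochner_integral_integrable[OF integrable_weighted_cay_powi[OF f(2), of "int m"]]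
      by (simp add: circle_coeff_def)
    have last: "2 * m - 1 < 2 * m" using m by simp
    have ef0: "Lplus m (\<lambda>x. of_real (\<phi> (2 * m - 1) x)) (\<lambda>x. of_real 0 * of_real (\<phi> (2 * m - 1) x))"
      using ef[OF last] unfolding E0 .
    obtain b where b: "AE x in lborel. \<phi> (2 * m - 1) x = b * Im (cay x ^ m)"
      using zero_mode[OF ef0] .
    note vr = integrable_L2_rho[OF eigen_L2[OF ef0]]
    note [measurable] = f(1) vr(1)
    have b0: "b \<noteq> 0"
    proof
      assume z: "b = 0"
      have "AE x in lborel. (\<phi> (2 * m - 1) x)\<^sup>2 = 0"
        using b by eventually_elim (simp add: z)
      then have "(LINT x|lborel. (\<phi> (2 * m - 1) x)\<^sup>2) = 0" by (rule integral_eq_zero_AE)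
      then show False using norm1[OF last] by simp
    qed
    have "Im (circle_coeff f (int m)) = 0"
    proof -
      have "0 = (LINT x|lborel. psi m \<phi> (2 * m - 1) x * f x)" using orth[of "2 * m - 1"] by simp
      also have "\<dots> = (LINT x|lborel. b / 2 * Im (of_real (f x * rho x) * cay x ^ m))"
      proof (rule integral_cong_AE)
        have psi_last: "psi m \<phi> (2 * m - 1) x * f x = \<phi> (2 * m - 1) x * (rho x / 2 * f x)" for x
        proof -
          have "\<not> 2 * m - 1 \<le> 2 * m - 2" using m by auto
          then have "psi m \<phi> (2 * m - 1) x = \<phi> (2 * m - 1) x / (1 + x\<^sup>2)"
            by (simp add: psi_def)
          then show ?thesis by (simp only: divide_eq_rho_half mult.assoc)
        qed
        show "AE x in lborel. psi m \<phi> (2 * m - 1) x * f x = b / 2 * Im (of_real (f x * rho x) * cay x ^ m)"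
          using b
        proof eventually_elim
          case (elim x)
          show ?case unfolding psi_last elim by simp
        qed
        show "(\<lambda>x. psi m \<phi> (2 * m - 1) x * f x) \<in> borel_measurable lborel"
          unfolding psi_last by measurable
      qed measurable
      also have "\<dots> = b / 2 * Im (circle_coeff f (int m))"
        using has_bochner_integral_integral_eq[OF has_bochner_integral_mult_right[OF has_bochner_integral_Im[OF C]]] by simp
      finally show ?thesis using b0 by simp
    qed
    moreover have "Re (circle_coeff f (int m)) = 0"
    proof -
      define s where "s = (if odd m then Im ((- \<i>) ^ m) else Re ((- \<i>) ^ m))"
      have i2: "(- \<i>) ^ (2 * k) = (- 1) ^ k" for k by (simp add: power_mult)
      \<comment> \<open>The resonance is the real or imaginary part of \<open>(- i \<zeta>)\<^sup>m\<close>. In both parities this is \<open>\<plusminus> Re (\<zeta>\<^sup>m)\<close>.\<close>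
      have split: "(- \<i>) ^ m = (if odd m then \<i> * of_real s else of_real s)"
      proof (cases "odd m")
        case True
        then obtain k where "m = 2 * k + 1" by (rule oddE)
        then have "(- \<i>) ^ m = - \<i> * (- 1) ^ k" by (simp add: i2 power_add)
        then show ?thesis using True unfolding s_def by (auto simp: minus_one_power_iff)
      next
        case False
        then obtain k where "m = 2 * k" by (auto elim: evenE)
        then show ?thesis using False unfolding s_def by (auto simp: i2 minus_one_power_iff)
      qed
      have "s \<noteq> 0"
      proof
        assume "s = 0"
        then have "(- \<i>) ^ m = 0" unfolding split by simp
        then show False by simp
      qed
      have res: "resonance m x = s * Re (cay x ^ m)" for x
        unfolding resonance_def f_fun_def g_fun_def moebius_eq power_mult_distrib split by simp
      have "0 = (LINT x|lborel. psi m \<phi> (2 * m) x * f x)" using orth[of "2 * m"] by simp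
      also have "\<dots> = (LINT x|lborel. s / 2 * Re (of_real (f x * rho x) * cay x ^ m))"
      proof (rule Bochner_Integration.integral_cong)
        fix x
        have "\<not> 2 * m \<le> 2 * m - 2" "2 * m \<noteq> 2 * m - 1" using m by auto
        then show "psi m \<phi> (2 * m) x * f x = s / 2 * Re (of_real (f x * rho x) * cay x ^ m)"
          by (simp add: psi_def res divide_eq_rho_half)
      qed simp
      also have "\<dots> = s / 2 * Re (circle_coeff f (int m))"
        using has_bochner_integral_integral_eq[OF has_bochner_integral_mult_right[OF has_bochner_integral_Re[OF C]]] by simp
      finally show ?thesis using \<open>s \<noteq> 0\<close> by simp
    qed
    ultimately show ?thesis by (simp add: complex_eq_iff)
  qed
  consider "\<bar>p\<bar> < int m" | "p = int m" | "p = - int m" using p by linarith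
  then show ?thesis
    by cases (use inner outer circle_coeff_uminus[of f "int m"] in auto)
qed

theorem corollary3p1:
  fixes m :: nat
    and E :: "nat \<Rightarrow> real"
    and \<phi> :: "nat \<Rightarrow> real \<Rightarrow> real"
    and f g :: "real \<Rightarrow> real"
  assumes "m \<ge> 1"
    and "strict_mono_on {..<2 * m} E"
    and "(\<lambda>k. complex_of_real (E k)) ` {..<2 * m} = Lplus_eigenvalues m"
    and "E (2 * m - 1) = 0"
    and "\<And>k. k < 2 * m \<Longrightarrow>
           Lplus_eigenfunction m (complex_of_real (E k)) (\<lambda>x. complex_of_real (\<phi> k x))"
    and "\<And>k. k < 2 * m \<Longrightarrow> (LINT x|lborel. (\<phi> k x)\<^sup>2) = 1"
    and "f \<in> Hdot_half" and "g \<in> Hdot_half"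
    and "\<And>k. k \<le> 2 * m \<Longrightarrow> (LINT x|lborel. psi m \<phi> k x * f x) = 0"
    and "\<And>k. k \<le> 2 * m \<Longrightarrow> (LINT x|lborel. psi m \<phi> k x * g x) = 0"
  shows "Lplus_form m f + Lminus_form m g
           \<ge> 1 / (real m + 1) * (Hdot_half_norm_sq f + Hdot_half_norm_sq g)"
proof -
  have low: "circle_coeff h p = 0"
    if h: "h \<in> Hdot_half" "\<And>k. k \<le> 2 * m \<Longrightarrow> (LINT x|lborel. psi m \<phi> k x * h x) = 0" and p: "\<bar>p\<bar> \<le> int m" for h p
    using low_circle_coeff_zero[OF assms(1,2,4) _ assms(6) _ Hdot_half_weighted_integrable[OF h(1)] h(2) p]
      assms(5) h(1) by (simp add: Lplus_eigenfunction_def Hdot_half_def)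
  have lowf: "circle_coeff f p = 0" and lowg: "circle_coeff g p = 0" if "\<bar>p\<bar> \<le> int m" for p
    using low assms(7-10) that by auto
  have "R_op m g x = 0" for x
    using R_op_eq_0[OF _ Hdot_half_weighted_integrable[OF assms(8)]] lowg assms(8) by (simp add: Hdot_half_def)
  then have "Lminus_form m g = Lplus_form m g" by (simp add: Lminus_form_def)
  moreover have "1 / (real m + 1) * Hdot_half_norm_sq f \<le> Lplus_form m f"
    using assms(7) lowf by (rule Lplus_form_ge)
  moreover have "1 / (real m + 1) * Hdot_half_norm_sq g \<le> Lplus_form m g"
    using assms(8) lowg by (rule Lplus_form_ge)
  ultimately show ?thesis by (simp only: distrib_left add_mono)
qed

end
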